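(* Let $N\ge1$. (a) If a norm $q$ on $\mathbb{P}(\mathbb{C}^N)$ has the generalized Nikolskii property with the spectral norm $q_\sigma$, then $$m^*(q)=m(q)\iff m(q)=m(q_\sigma).$$ (b) Let $q=\|\cdot\|$ be a norm on $\mathbb{P}(\mathbb{C}^N)$ having the generalized Nikolskii property with the spectral norm $q_\sigma$. If, for some constant $M>0$, Markov's inequality $$\left\|\frac{\partial P}{\partial x_j}\right\|\le M(\deg P)^{m(q_\sigma)}\|P\|,\qquad j=1,\dots,N,\ P\in\mathbb{P}(\mathbb{C}^N),$$ holds, then the exponent $m(q_\sigma)$ is the best possible (no smaller exponent can be used in such an inequality for $q$). In particular, $m(q)=m(q_\sigma)$. (c) If $E$ is a compact UPC subset of $\mathbb{R}^N$ and $1\le p<\infty$, then $m_p(E)\ge m(E)$, where $m_p(E)$ denotes Markov's exponent $m(q)$ of the norm $q(P)=\left(\int_E|P|^p\,d\mu\right)^{1/p}$, $\mu$ being the normalized Lebesgue measure on $E$.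
   Context: $\mathbb{P}(\mathbb{C}^N)$ is the complex vector space of all polynomials in $N$ variables with complex coefficients, $\deg P$ is the total degree, and $\|P\|_E=\sup_E|P|$ for compact $E$. A norm $q_\sigma$ on $\mathbb{P}(\mathbb{C}^N)$ is spectral if $q_\sigma(P^n)=(q_\sigma(P))^n$ for all $P$ and all integers $n\ge1$. A norm $q$ on $\mathbb{P}(\mathbb{C}^N)$ has the generalized Nikolskii property with the spectral norm $q_\sigma$ if there exist constants $A,B>0$ and $a,b\ge0$ such that for every $P\in\mathbb{P}(\mathbb{C}^N)$ with $\deg P\ge1$, $q_\sigma(P)\le A(\deg P)^aq(P)$ and $q(P)\le B(\deg P)^bq_\sigma(P)$. For a norm $q$ on $\mathbb{P}(\mathbb{C}^N)$ and a multi-index $\alpha\in\mathbb{Z}_{\ge0}^N$ with $|\alpha|=\alpha_1+\dots+\alpha_N\ge1$, let $$m(\alpha,q)=\inf\{s>0:\ \exists M>0\ \forall P\in\mathbb{P}(\mathbb{C}^N)\ \ q(D^\alpha P)\le M(\deg P)^s q(P)\},$$ with $\inf\emptyset=+\infty$ and $D^\alpha=\partial^{|\alpha|}/\partial x_1^{\alpha_1}\cdots\partial x_N^{\alpha_N}$. For $k\ge1$ put $m_k(q)=\max\{m(\alpha,q):|\alpha|=k\}$. Markov's exponent of $q$ is $m(q)=m_1(q)$, the asymptotic exponent of $q$ is $m^*(q)=\limsup_{k\to\infty}\frac1k m_k(q)$, and Markov's exponent of a compact set $E$ is $m(E)=m(\|\cdot\|_E)$. A (nonempty) set $E\subset\mathbb{R}^N$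 is uniformly polynomially cuspidal (UPC) if there exist constants $M,m>0$ and a positive integer $d$ such that for each $x\in\overline{E}$ there is a polynomial map $h_x:\mathbb{R}\to\mathbb{R}^N$ of degree at most $d$ with $h_x(0)=x$, $h_x([0,1])\subset\overline{E}$ and $\operatorname{dist}(h_x(t),\mathbb{R}^N\setminus E)\ge Mt^m$ for all $t\in[0,1]$. *)

theory Defs
  imports "HOL-Analysis.Analysis" "HOL-Library.Poly_Mapping"
begin

text \<open>
  Polynomials over \<open>\<complex>\<close> in the variables \<open>x\<^sub>i\<close>, \<open>i :: 'n\<close>, where \<open>N = CARD('n)\<close>: a multi-index (equivalently,
  a monomial) is a map \<open>'n \<Rightarrow>\<^sub>0 nat\<close>, and a polynomial maps multi-indices to coefficients. The ring
  structure, in particular \<open>P ^ n\<close>, is the one of theory \<open>Poly_Mapping\<close>.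
\<close>

type_synonym 'n multi_index = "'n \<Rightarrow>\<^sub>0 nat"
type_synonym 'n cpoly = "('n \<Rightarrow>\<^sub>0 nat) \<Rightarrow>\<^sub>0 complex"

definition mi_abs :: "'n::finite multi_index \<Rightarrow> nat" where
  "mi_abs \<alpha> = (\<Sum>i\<in>UNIV. Poly_Mapping.lookup \<alpha> i)"

text \<open>The zero polynomial gets degree \<open>0\<close>; it only ever occurs in inequalities \<open>0 \<le> 0\<close>.\<close>

definition total_degree :: "'n::finite cpoly \<Rightarrow> nat" where
  "total_degree P = Max (insert 0 (mi_abs ` Poly_Mapping.keys P))"

definition scale_poly :: "complex \<Rightarrow> 'n cpoly \<Rightarrow> 'n cpoly" where
  "scale_poly c P = Poly_Mapping.map (\<lambda>a. c * a) P"

definition eval_poly :: "'n::finite cpoly \<Rightarrow> complex ^ 'n \<Rightarrow> complex" where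
  "eval_poly P x =
     (\<Sum>\<alpha>\<in>Poly_Mapping.keys P. Poly_Mapping.lookup P \<alpha> * (\<Prod>i\<in>UNIV. (x $ i) ^ Poly_Mapping.lookup \<alpha> i))"

text \<open>
  \<open>\<partial>/\<partial>x\<^sub>i\<close>. If \<open>x\<^sub>i\<close> does not occur in the monomial \<open>\<alpha>\<close>, then the subtraction truncates, but the coefficient
  is \<open>0\<close>.
\<close>

definition partial_deriv :: "'n \<Rightarrow> 'n cpoly \<Rightarrow> 'n cpoly" where
  "partial_deriv i P =
     (\<Sum>\<alpha>\<in>Poly_Mapping.keys P.
        Poly_Mapping.single (\<alpha> - Poly_Mapping.single i 1)
          (of_nat (Poly_Mapping.lookup \<alpha> i) * Poly_Mapping.lookup P \<alpha>))"

lemma lookup_partial_deriv: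
  "Poly_Mapping.lookup (partial_deriv i P) \<beta> =
     of_nat (Suc (Poly_Mapping.lookup \<beta> i)) * Poly_Mapping.lookup P (\<beta> + Poly_Mapping.single i 1)"
proof -
  let ?e = "Poly_Mapping.single i (1::nat)"
  have eq: "(\<alpha> - ?e = \<beta> \<and> Poly_Mapping.lookup \<alpha> i \<noteq> 0) \<longleftrightarrow> \<alpha> = \<beta> + ?e" for \<alpha>
  proof
    assume h: "\<alpha> - ?e = \<beta> \<and> Poly_Mapping.lookup \<alpha> i \<noteq> 0"
    show "\<alpha> = \<beta> + ?e"
    proof (rule poly_mapping_eqI)
      fix k
      have "Poly_Mapping.lookup \<beta> k = Poly_Mapping.lookup \<alpha> k - Poly_Mapping.lookup ?e k"
        using h lookup_minus[of \<alpha> ?e k] by simp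
      thus "Poly_Mapping.lookup \<alpha> k = Poly_Mapping.lookup (\<beta> + ?e) k"
        using h by (cases "k = i") (auto simp: lookup_add lookup_single)
    qed
  qed (simp add: lookup_add)
  have "Poly_Mapping.lookup (partial_deriv i P) \<beta> =
      (\<Sum>\<alpha>\<in>Poly_Mapping.keys P. if \<alpha> = \<beta> + ?e
         then of_nat (Poly_Mapping.lookup \<alpha> i) * Poly_Mapping.lookup P \<alpha> else 0)"
    unfolding partial_deriv_def lookup_sum
  proof (rule sum.cong[OF refl])
    fix \<alpha>
    show "Poly_Mapping.lookup (Poly_Mapping.single (\<alpha> - ?e)
            (of_nat (Poly_Mapping.lookup \<alpha> i) * Poly_Mapping.lookup P \<alpha>)) \<beta> =
          (if \<alpha> = \<beta> + ?e then of_nat (Poly_Mapping.lookup \<alpha> i) * Poly_Mapping.lookup P \<alpha> else 0)"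
      using eq[of \<alpha>] by (cases "\<alpha> = \<beta> + ?e") (auto simp: lookup_single when_def)
  qed
  also have "\<dots> = of_nat (Suc (Poly_Mapping.lookup \<beta> i)) * Poly_Mapping.lookup P (\<beta> + ?e)"
    by (auto simp: sum.delta lookup_add in_keys_iff)
  finally show ?thesis .
qed

lemma partial_deriv_commute: "partial_deriv i (partial_deriv j P) = partial_deriv j (partial_deriv i P)"
  by (rule poly_mapping_eqI)
    (cases "i = j"; simp add: lookup_partial_deriv lookup_add lookup_single when_def ac_simps)

text \<open>\<open>D\<^sup>\<alpha>\<close>: apply \<open>\<partial>/\<partial>x\<^sub>i\<close> exactly \<open>\<alpha>\<^sub>i\<close> times for every \<open>i\<close>; the order is irrelevant.\<close>

definition multi_deriv :: "'n::finite multi_index \<Rightarrow> 'n cpoly \<Rightarrow> 'n cpoly" where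
  "multi_deriv \<alpha> P = Finite_Set.fold (\<lambda>i. partial_deriv i ^^ Poly_Mapping.lookup \<alpha> i) P UNIV"

lemma partial_deriv_funpow_commute:
  "(partial_deriv i ^^ m) ((partial_deriv j ^^ n) P) = (partial_deriv j ^^ n) ((partial_deriv i ^^ m) P)"
proof -
  have 1: "partial_deriv i ((partial_deriv j ^^ n) P) = (partial_deriv j ^^ n) (partial_deriv i P)" for P
    by (induction n) (auto simp: partial_deriv_commute[of i j])
  show ?thesis
    by (induction m) (auto simp: 1)
qed

lemma comp_fun_commute_partial_deriv:
  "comp_fun_commute (\<lambda>i. partial_deriv i ^^ Poly_Mapping.lookup \<alpha> i)"
  by unfold_locales (auto simp: fun_eq_iff partial_deriv_funpow_commute)

lemma multi_deriv_0 [simp]: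
  fixes P :: "'n::finite cpoly"
  shows "multi_deriv 0 P = P"
proof -
  interpret comp_fun_commute "\<lambda>i. (id :: 'n cpoly \<Rightarrow> 'n cpoly)"
    by unfold_locales simp
  have "Finite_Set.fold (\<lambda>i. (id :: 'n cpoly \<Rightarrow> 'n cpoly)) P A = P" if "finite A" for A :: "'n set"
    using that
  proof induction
    case (insert i A)
    show ?case
      unfolding fold_insert[OF insert.hyps] insert.IH by simp
  qed simp
  thus ?thesis
    by (simp add: multi_deriv_def id_def)
qed

lemma multi_deriv_add_single:
  "multi_deriv (\<alpha> + Poly_Mapping.single j 1) P = partial_deriv j (multi_deriv \<alpha> P)"
proof -
  define f where "f = (\<lambda>i. partial_deriv i ^^ Poly_Mapping.lookup \<alpha> i)"
  define g where "g = (\<lambda>i. partial_deriv i ^^ Poly_Mapping.lookup (\<alpha> + Poly_Mapping.single j 1) i)"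
  interpret f: comp_fun_commute f
    unfolding f_def by (rule comp_fun_commute_partial_deriv)
  interpret g: comp_fun_commute g
    unfolding g_def by (rule comp_fun_commute_partial_deriv)
  have g_eq: "g i = f i" if "i \<noteq> j" for i
    using that by (simp add: f_def g_def lookup_add lookup_single)
  have g_j: "g j = partial_deriv j \<circ> f j"
    by (simp add: f_def g_def lookup_add)
  have "Finite_Set.fold g P A = Finite_Set.fold f P A" if "finite A" "j \<notin> A" for A
    using that
  proof induction
    case (insert i A)
    show ?case
      unfolding f.fold_insert[OF insert.hyps] g.fold_insert[OF insert.hyps]
      using insert by (auto simp: g_eq)
  qed simp
  hence "Finite_Set.fold g P (UNIV - {j}) = Finite_Set.fold f P (UNIV - {j})"
    by simp
  hence "Finite_Set.fold g P (insert j (UNIV - {j})) =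
         partial_deriv j (Finite_Set.fold f P (insert j (UNIV - {j})))"
    by (simp only: f.fold_insert g.fold_insert finite g_j comp_apply Diff_iff insertI1 simp_thms)
  thus ?thesis
    by (simp add: multi_deriv_def f_def g_def insert_UNIV)
qed

lemma multi_deriv_single [simp]: "multi_deriv (Poly_Mapping.single j 1) P = partial_deriv j P"
  using multi_deriv_add_single[of 0 j P] by simp

definition poly_norm :: "('n cpoly \<Rightarrow> real) \<Rightarrow> bool" where
  "poly_norm q \<longleftrightarrow>
     (\<forall>P. 0 \<le> q P) \<and> (\<forall>P. q P = 0 \<longleftrightarrow> P = 0) \<and>
     (\<forall>c P. q (scale_poly c P) = cmod c * q P) \<and>
     (\<forall>P Q. q (P + Q) \<le> q P + q Q)"

definition spectral_norm :: "('n cpoly \<Rightarrow> real) \<Rightarrow> bool" where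
  "spectral_norm q \<longleftrightarrow> poly_norm q \<and> (\<forall>P. \<forall>n\<ge>1. q (P ^ n) = q P ^ n)"

definition generalized_nikolskii ::
    "('n::finite cpoly \<Rightarrow> real) \<Rightarrow> ('n cpoly \<Rightarrow> real) \<Rightarrow> bool" where
  "generalized_nikolskii q q\<^sub>\<sigma> \<longleftrightarrow>
     poly_norm q \<and> spectral_norm q\<^sub>\<sigma> \<and>
     (\<exists>A>0. \<exists>B>0. \<exists>a\<ge>0. \<exists>b\<ge>0. \<forall>P. 1 \<le> total_degree P \<longrightarrow>
        q\<^sub>\<sigma> P \<le> A * real (total_degree P) powr a * q P \<and>
        q P \<le> B * real (total_degree P) powr b * q\<^sub>\<sigma> P)"

text \<open>\<open>m(\<alpha>, q)\<close>, \<open>m\<^sub>k(q)\<close>, \<open>m(q)\<close> and \<open>m\<^sup>*(q)\<close>; in \<open>ereal\<close>, the infimum of the empty set is \<open>\<infinity>\<close>.\<close>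

definition deriv_exponent :: "'n::finite multi_index \<Rightarrow> ('n cpoly \<Rightarrow> real) \<Rightarrow> ereal" where
  "deriv_exponent \<alpha> q =
     (INF s \<in> {s. 0 < s \<and> (\<exists>M>0. \<forall>P. q (multi_deriv \<alpha> P) \<le> M * real (total_degree P) powr s * q P)}.
        ereal s)"

lemma finite_multi_indices: "finite {\<alpha> :: 'n::finite multi_index. mi_abs \<alpha> = k}"
proof (rule finite_imageD)
  have "Poly_Mapping.lookup \<alpha> i \<le> mi_abs \<alpha>" for \<alpha> :: "'n multi_index" and i
    unfolding mi_abs_def by (rule member_le_sum) auto
  hence "Poly_Mapping.lookup ` {\<alpha> :: 'n multi_index. mi_abs \<alpha> = k} \<subseteq> PiE UNIV (\<lambda>_. {..k})"
    by auto
  thus "finite (Poly_Mapping.lookup ` {\<alpha> :: 'n multi_index. mi_abs \<alpha> = k})"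
    by (rule finite_subset) (simp add: finite_PiE)
  show "inj_on Poly_Mapping.lookup {\<alpha> :: 'n multi_index. mi_abs \<alpha> = k}"
    by (auto simp: inj_on_def)
qed

definition kth_exponent :: "nat \<Rightarrow> ('n::finite cpoly \<Rightarrow> real) \<Rightarrow> ereal" where
  "kth_exponent k q = Max {deriv_exponent \<alpha> q |\<alpha>. mi_abs \<alpha> = k}"

definition markov_exponent :: "('n::finite cpoly \<Rightarrow> real) \<Rightarrow> ereal" where
  "markov_exponent q = kth_exponent 1 q"

definition asymptotic_exponent :: "('n::finite cpoly \<Rightarrow> real) \<Rightarrow> ereal" where
  "asymptotic_exponent q = limsup (\<lambda>k. ereal (1 / real k) * kth_exponent k q)"

definition markov_inequality :: "('n::finite cpoly \<Rightarrow> real) \<Rightarrow> real \<Rightarrow> real \<Rightarrow> bool" where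
  "markov_inequality q M s \<longleftrightarrow>
     (\<forall>j P. q (partial_deriv j P) \<le> M * real (total_degree P) powr s * q P)"

definition of_real_vec :: "real ^ 'n \<Rightarrow> complex ^ 'n" where
  "of_real_vec x = (\<chi> i. complex_of_real (x $ i))"

definition sup_norm :: "(complex ^ 'n::finite) set \<Rightarrow> 'n cpoly \<Rightarrow> real" where
  "sup_norm E P = (SUP x\<in>E. cmod (eval_poly P x))"

definition set_markov_exponent :: "(complex ^ 'n::finite) set \<Rightarrow> ereal" where
  "set_markov_exponent E = markov_exponent (sup_norm E)"

text \<open>\<open>uniform_measure lborel E\<close> is Lebesgue measure restricted to \<open>E\<close>, divided by the measure of \<open>E\<close>.\<close>

definition Lp_norm :: "real \<Rightarrow> (real ^ 'n::finite) set \<Rightarrow> 'n cpoly \<Rightarrow> real" where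
  "Lp_norm p E P =
     (LINT x|uniform_measure lborel E. cmod (eval_poly P (of_real_vec x)) powr p) powr (1 / p)"

definition polynomial_map :: "nat \<Rightarrow> (real \<Rightarrow> real ^ 'n) \<Rightarrow> bool" where
  "polynomial_map d h \<longleftrightarrow>
     (\<exists>c :: 'n \<Rightarrow> real poly. \<forall>i. degree (c i) \<le> d \<and> (\<forall>t. h t $ i = poly (c i) t))"

text \<open>Unlike with \<open>infdist\<close>, the distance to the empty set is \<open>\<infinity>\<close>.\<close>

definition set_dist :: "'a::metric_space \<Rightarrow> 'a set \<Rightarrow> ereal" where
  "set_dist x S = (INF y\<in>S. ereal (dist x y))"

definition UPC :: "(real ^ 'n::finite) set \<Rightarrow> bool" where
  "UPC E \<longleftrightarrow> E \<noteq> {} \<and>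
     (\<exists>M>0. \<exists>m>0. \<exists>d\<ge>1. \<forall>x\<in>closure E. \<exists>h.
        polynomial_map d h \<and> h 0 = x \<and> h ` {0..1} \<subseteq> closure E \<and>
        (\<forall>t\<in>{0..1}. ereal (M * t powr m) \<le> set_dist (h t) (- E)))"

end

theory Submission
  imports Defs "HOL-Complex_Analysis.Cauchy_Integral_Formula" "HOL-Probability.Probability_Measure"
begin

text \<open>
  Everything rests on one identity: if \<open>q\<close> has the generalized Nikolskii property with the spectral norm
  \<open>q\<^sub>\<sigma>\<close>, then \<open>m\<^sub>k(q) / k\<close> tends to \<open>m(q\<^sub>\<sigma>)\<close> (\<open>kth_exponent_tendsto\<close>), so \<open>m\<^sup>*(q) = m(q\<^sub>\<sigma>)\<close>.
  Part (a) is then immediate. Three facts yield the limit.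

  \<^item> Iterating Markov's inequality gives \<open>m\<^sub>k(q) \<le> k m(q)\<close>; consequently \<open>m(q\<^sub>\<sigma>) \<le> m(q)\<close> once the limit is known.

  \<^item> For a spectral norm the converse \<open>k m(q\<^sub>\<sigma>) \<le> m\<^sub>k(q\<^sub>\<sigma>)\<close> holds. A spectral norm is submultiplicative, and
    \<open>k! (D P)\<^sup>k\<close> is a combination of the products \<open>P\<^sup>k\<^sup>-\<^sup>l D\<^sup>k (P\<^sup>l)\<close>, \<open>l \<le> k\<close>, with coefficients whose absolute
    values add up to \<open>2\<^sup>k\<close>. A bound for \<open>D\<^sup>k\<close> thus bounds \<open>q\<^sub>\<sigma>(D P)\<^sup>k\<close>, and a \<open>k\<close>-th root divides the exponent
    by \<open>k\<close>.

  \<^item> The Nikolskii inequalities change every exponent by at most a constant that does not depend on the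
    order \<open>k\<close> of the derivative; division by \<open>k\<close> makes this error vanish.

  For part (b), an inequality with exponent \<open>s > 0\<close> gives \<open>m(q\<^sub>\<sigma>) \<le> m(q) \<le> s\<close>. Exponents \<open>s \<le> 0\<close> cannot occur:
  differentiating \<open>x\<^sub>j\<^sup>k\<close> exactly \<open>k\<close> times produces \<open>k!\<close>, whereas the \<open>k\<close>-fold inequality would allow only
  geometric growth.

  Part (c) is the inequality \<open>m(q\<^sub>\<sigma>) \<le> m(q)\<close> for the \<open>L\<^sup>p\<close> norm and the supremum norm on \<open>E\<close>. The work lies in
  \<open>\<parallel>P\<parallel>\<^sub>E \<le> A (deg P)\<^sup>a \<parallel>P\<parallel>\<^sub>p\<close>. Starting at a point where \<open>|P|\<close> is maximal, a short walk along the curve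
  \<open>h\<^sub>x\<close> leads to a point in the interior of \<open>E\<close> where \<open>|P|\<close> is at least half the maximum; on a ball around that
  point, with radius a negative power of \<open>deg P\<close>, it is still at least a quarter of it. Both steps need only that a
  polynomial of degree \<open>n\<close> that is bounded on an interval cannot vary faster than a power of \<open>n\<close> allows. This
  follows by substituting \<open>(z + 1/z) / 2\<close> and using Cauchy's estimate for the coefficients on the unit
  circle.
\<close>

section \<open>Polynomials, their degrees and their derivatives\<close>

lemma cpoly_eq_sum_monomials:
  "P = (\<Sum>\<alpha>\<in>Poly_Mapping.keys P. Poly_Mapping.single \<alpha> (Poly_Mapping.lookup P \<alpha>))"
  by (rule poly_mapping_eqI) (auto simp: lookup_sum lookup_single when_def in_keys_iff)

lemma cpoly_induct [case_names monomial add]: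
  assumes "\<And>\<alpha> c. R (Poly_Mapping.single \<alpha> c)" and "\<And>P Q. R P \<Longrightarrow> R Q \<Longrightarrow> R (P + Q)"
  shows "R (P :: ('a \<Rightarrow>\<^sub>0 nat) \<Rightarrow>\<^sub>0 'b::comm_monoid_add)"
proof -
  have "R (\<Sum>\<alpha>\<in>A. Poly_Mapping.single \<alpha> (Poly_Mapping.lookup P \<alpha>))" if "finite A" for A
    using that assms(1)[of 0 0] by induction (auto intro!: assms)
  from this[OF finite_keys[of P]] show ?thesis
    using cpoly_eq_sum_monomials[of P] by simp
qed

lemma mi_abs_add: "mi_abs (\<alpha> + \<beta>) = mi_abs \<alpha> + mi_abs \<beta>"
  by (simp add: mi_abs_def lookup_add sum.distrib)

lemma mi_abs_single [simp]: "mi_abs (Poly_Mapping.single i k) = k"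
  by (simp add: mi_abs_def lookup_single when_def)

lemma mi_abs_eq_0_iff: "mi_abs \<alpha> = 0 \<longleftrightarrow> \<alpha> = 0"
  by (auto simp: mi_abs_def poly_mapping_eq_iff fun_eq_iff)

lemma mi_abs_SucE:
  assumes "mi_abs \<alpha> = Suc k"
  obtains \<beta> j where "\<alpha> = \<beta> + Poly_Mapping.single j 1" "mi_abs \<beta> = k"
proof -
  obtain j where j: "Poly_Mapping.lookup \<alpha> j \<noteq> 0"
    using assms by (metis mi_abs_eq_0_iff lookup_zero nat.distinct(1) poly_mapping_eqI)
  have *: "\<alpha> = (\<alpha> - Poly_Mapping.single j 1) + Poly_Mapping.single j 1"
    using j by (intro poly_mapping_eqI) (auto simp: lookup_add lookup_minus lookup_single when_def)
  moreover have "mi_abs (\<alpha> - Poly_Mapping.single j 1) = k"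
    using assms arg_cong[OF *, of mi_abs] by (simp add: mi_abs_add)
  ultimately show thesis by (rule that)
qed

lemma mi_abs_1E:
  assumes "mi_abs \<alpha> = 1"
  obtains j where "\<alpha> = Poly_Mapping.single j 1"
  using assms by (metis One_nat_def add_0 mi_abs_SucE mi_abs_eq_0_iff)

lemma total_degree_le_iff: "total_degree P \<le> n \<longleftrightarrow> (\<forall>\<alpha>\<in>Poly_Mapping.keys P. mi_abs \<alpha> \<le> n)"
  by (auto simp: total_degree_def)

lemma mi_abs_le_total_degree: "\<alpha> \<in> Poly_Mapping.keys P \<Longrightarrow> mi_abs \<alpha> \<le> total_degree P"
  using total_degree_le_iff by blast

lemma total_degree_mult_le: "total_degree (P * Q) \<le> total_degree P + total_degree Q"
  unfolding total_degree_le_iff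
proof
  fix \<gamma> assume "\<gamma> \<in> Poly_Mapping.keys (P * Q)"
  then obtain \<alpha> \<beta> where "\<gamma> = \<alpha> + \<beta>" "\<alpha> \<in> Poly_Mapping.keys P" "\<beta> \<in> Poly_Mapping.keys Q"
    using keys_mult[of P Q] by blast
  thus "mi_abs \<gamma> \<le> total_degree P + total_degree Q"
    by (auto simp: mi_abs_add intro!: add_mono mi_abs_le_total_degree)
qed

lemma total_degree_one [simp]: "total_degree 1 = 0"
  by (simp add: total_degree_def mi_abs_def)

lemma total_degree_power_le: "total_degree (P ^ n) \<le> n * total_degree P"
  by (induction n) (auto intro: order_trans[OF total_degree_mult_le])

lemma total_degree_partial_deriv_le: "total_degree (partial_deriv j P) \<le> total_degree P"
  unfolding total_degree_le_iff
proof
  fix \<beta> assume "\<beta> \<in> Poly_Mapping.keys (partial_deriv j P)"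
  hence "\<beta> + Poly_Mapping.single j 1 \<in> Poly_Mapping.keys P"
    by (auto simp: in_keys_iff lookup_partial_deriv)
  thus "mi_abs \<beta> \<le> total_degree P"
    using mi_abs_le_total_degree by (fastforce simp: mi_abs_add)
qed

lemma total_degree_multi_deriv_le: "total_degree (multi_deriv \<alpha> P) \<le> total_degree P"
proof (induction "mi_abs \<alpha>" arbitrary: \<alpha>)
  case 0
  hence "\<alpha> = 0" by (simp add: mi_abs_eq_0_iff)
  thus ?case by simp
next
  case (Suc k)
  from Suc.hyps(2)[symmetric] obtain \<beta> j
    where "\<alpha> = \<beta> + Poly_Mapping.single j 1" "mi_abs \<beta> = k" by (rule mi_abs_SucE)
  thus ?case
    using Suc.hyps(1)[of \<beta>] total_degree_partial_deriv_le[of j "multi_deriv \<beta> P"]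
    by (simp only: multi_deriv_add_single) linarith
qed

lemma total_degree_eq_0D:
  assumes "total_degree P = 0"
  shows "P = Poly_Mapping.single 0 (Poly_Mapping.lookup P 0)"
proof (rule poly_mapping_eqI)
  fix \<alpha>
  have "Poly_Mapping.lookup P \<alpha> = 0" if "\<alpha> \<noteq> 0"
    using assms total_degree_le_iff[of P 0] that by (auto simp: mi_abs_eq_0_iff in_keys_iff)
  thus "Poly_Mapping.lookup P \<alpha> =
        Poly_Mapping.lookup (Poly_Mapping.single 0 (Poly_Mapping.lookup P 0)) \<alpha>"
    by (auto simp: lookup_single when_def)
qed

lemma scale_poly_conv_mult: "scale_poly c P = Poly_Mapping.single 0 c * P"
  by (simp add: scale_poly_def mult_map_scale_conv_mult)

lemma partial_deriv_single:
  "partial_deriv i (Poly_Mapping.single \<alpha> c) =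
     Poly_Mapping.single (\<alpha> - Poly_Mapping.single i 1) (of_nat (Poly_Mapping.lookup \<alpha> i) * c)"
  by (simp add: partial_deriv_def)

lemma partial_deriv_add: "partial_deriv i (P + Q) = partial_deriv i P + partial_deriv i Q"
  by (rule poly_mapping_eqI) (simp add: lookup_partial_deriv lookup_add algebra_simps)

lemma partial_deriv_diff: "partial_deriv i (P - Q) = partial_deriv i P - partial_deriv i Q"
  by (rule poly_mapping_eqI) (simp add: lookup_partial_deriv lookup_minus algebra_simps)

lemma partial_deriv_mult:
  "partial_deriv i (P * Q) = partial_deriv i P * Q + P * partial_deriv i Q"
proof (induction P rule: cpoly_induct)
  case (monomial \<alpha> a)
  show ?case
  proof (induction Q rule: cpoly_induct)
    case (monomial \<beta> b)
    let ?e = "Poly_Mapping.single i (1::nat)"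
    have l: "Poly_Mapping.single (\<alpha> - ?e + \<beta>) (of_nat (Poly_Mapping.lookup \<alpha> i) * a * b) =
          Poly_Mapping.single (\<alpha> + \<beta> - ?e) (of_nat (Poly_Mapping.lookup \<alpha> i) * a * b)"
    proof (cases "Poly_Mapping.lookup \<alpha> i = 0")
      case False
      hence "\<alpha> - ?e + \<beta> = \<alpha> + \<beta> - ?e"
        by (intro poly_mapping_eqI) (auto simp: lookup_add lookup_minus lookup_single when_def)
      thus ?thesis by simp
    qed simp
    have r: "Poly_Mapping.single (\<alpha> + (\<beta> - ?e)) (a * (of_nat (Poly_Mapping.lookup \<beta> i) * b)) =
          Poly_Mapping.single (\<alpha> + \<beta> - ?e) (a * (of_nat (Poly_Mapping.lookup \<beta> i) * b))"
    proof (cases "Poly_Mapping.lookup \<beta> i = 0")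
      case False
      hence "\<alpha> + (\<beta> - ?e) = \<alpha> + \<beta> - ?e"
        by (intro poly_mapping_eqI) (auto simp: lookup_add lookup_minus lookup_single when_def)
      thus ?thesis by simp
    qed simp
    show ?case
      unfolding mult_single partial_deriv_single l r single_add[symmetric] lookup_add
      by (simp add: algebra_simps)
  qed (simp add: partial_deriv_add algebra_simps)
qed (simp add: partial_deriv_add algebra_simps)

lemma multi_deriv_single_power:
  "multi_deriv (Poly_Mapping.single j k) P = (partial_deriv j ^^ k) P"
proof (induction k)
  case (Suc k)
  have "Poly_Mapping.single j (Suc k) = Poly_Mapping.single j k + Poly_Mapping.single j 1"
    by (simp flip: single_add)
  with Suc show ?case by (simp only: multi_deriv_add_single funpow.simps o_apply)
qed simp

lemma higher_partial_deriv_var_power: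
  "(partial_deriv j ^^ k) (Poly_Mapping.single (Poly_Mapping.single j 1) 1 ^ k) =
     Poly_Mapping.single 0 (fact k)"
proof -
  have pow: "Poly_Mapping.single (Poly_Mapping.single j (1::nat)) (1::complex) ^ k =
      Poly_Mapping.single (Poly_Mapping.single j k) 1"
    by (induction k) (auto simp: mult_single simp flip: single_add)
  have "(partial_deriv j ^^ k) (Poly_Mapping.single (Poly_Mapping.single j k) c) =
      Poly_Mapping.single 0 (fact k * c)" for c
  proof (induction k arbitrary: c)
    case (Suc k)
    have "Poly_Mapping.single j (Suc k) - Poly_Mapping.single j 1 = Poly_Mapping.single j k"
      by (simp flip: single_diff)
    hence "partial_deriv j (Poly_Mapping.single (Poly_Mapping.single j (Suc k)) c) =
        Poly_Mapping.single (Poly_Mapping.single j k) (of_nat (Suc k) * c)"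
      by (simp add: partial_deriv_single)
    with Suc[of "of_nat (Suc k) * c"] show ?case
      by (simp add: funpow_swap1 algebra_simps)
  qed simp
  from this[of 1] pow show ?thesis by simp
qed

section \<open>Iterated commutators with a derivation\<close>

text \<open>
  The \<open>k\<close>-fold commutator of the operator \<open>L\<close> with multiplication by \<open>P\<close>. Expanded, it is the alternating
  binomial sum of \<open>P\<^sup>k\<^sup>-\<^sup>l L(P\<^sup>l f)\<close> over \<open>l \<le> k\<close>; the recursive form makes both the algebra and the norm
  estimates short inductions.
\<close>

fun iterated_commutator :: "('a \<Rightarrow> 'a) \<Rightarrow> 'a::comm_ring_1 \<Rightarrow> nat \<Rightarrow> 'a \<Rightarrow> 'a" where
  "iterated_commutator L P 0 f = L f"
| "iterated_commutator L P (Suc k) f =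
     iterated_commutator L P k (P * f) - P * iterated_commutator L P k f"

context
  fixes D :: "'a::comm_ring_1 \<Rightarrow> 'a"
  assumes diff: "\<And>f g. D (f - g) = D f - D g"
    and mult: "\<And>f g. D (f * g) = D f * g + f * D g"
begin

text \<open>
  Moving one \<open>D\<close> out of the commutator costs a commutator \<open>[D, P] = D P\<close> for each of the \<open>k\<close> factors.
\<close>

lemma iterated_commutator_derivation:
  "iterated_commutator (D ^^ Suc m) P k f =
     D (iterated_commutator (D ^^ m) P k f) +
     of_nat k * D P * iterated_commutator (D ^^ m) P (k - 1) f"
proof (induction k arbitrary: f)
  case (Suc k)
  have *: "of_nat k * D P * iterated_commutator (D ^^ m) P (k - 1) (P * f) -
        of_nat k * D P * (P * iterated_commutator (D ^^ m) P (k - 1) f) =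
        of_nat k * D P * iterated_commutator (D ^^ m) P k f"
    by (cases k) (auto simp: algebra_simps)
  show ?case
    using * unfolding iterated_commutator.simps Suc diff mult
    by (simp add: algebra_simps)
qed simp

lemma derivation_zero: "D 0 = 0"
  using diff[of 0 0] by simp

lemma iterated_commutator_id:
  "iterated_commutator (D ^^ 0) P k f = (if k = 0 then f else 0)"
  by (induction k arbitrary: f) auto

text \<open>
  A differential operator of order \<open>m\<close> loses one order with each commutator. After \<open>m\<close> of them only
  multiplication by \<open>m! (D P)\<^sup>m\<close> is left.
\<close>

lemma iterated_commutator_higher_derivation:
  "m \<le> k \<Longrightarrow> iterated_commutator (D ^^ m) P k f = (if k = m then of_nat (fact m) * D P ^ m * f else 0)"
proof (induction m arbitrary: k f)
  case 0
  show ?case using iterated_commutator_id[of P k f] by (auto simp: id_def)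
next
  case (Suc m)
  then obtain l where k: "k = Suc l" "m \<le> l" by (cases k) auto
  show ?case
    unfolding iterated_commutator_derivation using Suc k
    by (auto simp: derivation_zero algebra_simps)
qed

end

section \<open>Spectral norms are submultiplicative\<close>

context
  fixes q :: "'n::finite cpoly \<Rightarrow> real"
  assumes q: "poly_norm q"
begin

lemma poly_norm_nonneg: "0 \<le> q P"
  using q by (simp add: poly_norm_def)

lemma poly_norm_eq_0_iff: "q P = 0 \<longleftrightarrow> P = 0"
  using q by (simp add: poly_norm_def)

lemma poly_norm_zero: "q 0 = 0"
  using poly_norm_eq_0_iff by blast

lemma poly_norm_pos: "P \<noteq> 0 \<Longrightarrow> 0 < q P"
  using poly_norm_nonneg[of P] poly_norm_eq_0_iff[of P] by (simp add: less_le)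

lemma poly_norm_scale: "q (Poly_Mapping.single 0 c * P) = cmod c * q P"
  using q by (simp add: poly_norm_def scale_poly_conv_mult)

lemma poly_norm_triangle: "q (P + Q) \<le> q P + q Q"
  using q by (simp add: poly_norm_def)

lemma poly_norm_uminus: "q (- P) = q P"
  using poly_norm_scale[of "-1" P] by (simp add: single_uminus)

lemma poly_norm_triangle_diff: "q (P - Q) \<le> q P + q Q"
  using poly_norm_triangle[of P "- Q"] poly_norm_uminus[of Q] by simp

lemma poly_norm_const: "q (Poly_Mapping.single 0 c) = cmod c * q 1"
  using poly_norm_scale[of c 1] by simp

lemma poly_norm_of_nat_mult: "q (of_nat m * P) = real m * q P"
  using poly_norm_scale[of "of_nat m" P] by simp

lemma poly_norm_one_pos: "0 < q 1"
  by (rule poly_norm_pos) simp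

end

context
  fixes q :: "'n::finite cpoly \<Rightarrow> real"
  assumes spectral: "spectral_norm q"
begin

lemma spectral_norm_imp_poly_norm: "poly_norm q"
  using spectral by (simp add: spectral_norm_def)

lemma spectral_norm_one: "q 1 = 1"
proof -
  have "q (1 ^ 2) = q 1 ^ 2"
    using spectral by (simp only: spectral_norm_def one_le_numeral)
  thus ?thesis
    using poly_norm_one_pos[OF spectral_norm_imp_poly_norm] by (simp add: power2_eq_square)
qed

lemma spectral_norm_power: "q (P ^ n) = q P ^ n"
  using spectral spectral_norm_one by (cases "n = 0") (auto simp: spectral_norm_def)

text \<open>
  Products reduce to squares by polarization, \<open>4 U V = (U + V)\<^sup>2 - (U - V)\<^sup>2\<close>, applied to the normalized factors.
\<close>

lemma spectral_norm_mult_le_weak: "q (P * Q) \<le> 2 * (q P * q Q)"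
proof (cases "P = 0 \<or> Q = 0")
  case True
  thus ?thesis
    by (auto simp: poly_norm_zero[OF spectral_norm_imp_poly_norm])
next
  case False
  note norm = spectral_norm_imp_poly_norm
  have pos: "0 < q P" "0 < q Q"
    using False poly_norm_pos[OF norm] by auto
  define U where "U = Poly_Mapping.single 0 (complex_of_real (1 / q P)) * P"
  define V where "V = Poly_Mapping.single 0 (complex_of_real (1 / q Q)) * Q"
  have UV: "q U = 1" "q V = 1"
    using pos by (simp_all only: U_def V_def poly_norm_scale[OF norm]) (simp_all add: norm_divide)
  have polarization: "of_nat 4 * (U * V) = (U + V) ^ 2 - (U - V) ^ 2"
    by (simp add: power2_eq_square algebra_simps)
  have "4 * q (U * V) = q ((U + V) ^ 2 - (U - V) ^ 2)"
    unfolding polarization[symmetric] poly_norm_of_nat_mult[OF norm] by simp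
  also have "\<dots> \<le> q (U + V) ^ 2 + q (U - V) ^ 2"
    using poly_norm_triangle_diff[OF norm] by (simp flip: spectral_norm_power)
  also have "\<dots> \<le> 2 ^ 2 + 2 ^ 2"
    using poly_norm_triangle[OF norm, of U V] poly_norm_triangle_diff[OF norm, of U V] UV
    by (intro add_mono power_mono poly_norm_nonneg[OF norm]) auto
  finally have "q (U * V) \<le> 2" by simp
  moreover have "U * V = Poly_Mapping.single 0 (complex_of_real (1 / (q P * q Q))) * (P * Q)"
    by (simp add: U_def V_def mult_single algebra_simps flip: mult.assoc)
  hence "q (U * V) = q (P * Q) / (q P * q Q)"
    using pos by (simp only: poly_norm_scale[OF norm]) (simp add: norm_divide norm_mult)
  ultimately show ?thesis
    using pos by (simp add: field_simps)
qed

text \<open>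
  Applying the weak bound to \<open>P\<^sup>n\<close> and \<open>Q\<^sup>n\<close> replaces its constant \<open>2\<close> by the \<open>n\<close>-th root of \<open>2\<close>.
\<close>

lemma spectral_norm_mult_le: "q (P * Q) \<le> q P * q Q"
proof (rule ccontr)
  note norm = spectral_norm_imp_poly_norm
  assume "\<not> q (P * Q) \<le> q P * q Q"
  hence less: "q P * q Q < q (P * Q)" by simp
  hence "P \<noteq> 0" "Q \<noteq> 0"
    using poly_norm_zero[OF norm] by (cases "P = 0"; cases "Q = 0"; simp)+
  hence pos: "0 < q P * q Q"
    using poly_norm_pos[OF norm] by simp
  define r where "r = q (P * Q) / (q P * q Q)"
  have "1 < r"
    using less pos by (simp add: r_def)
  then obtain n where "2 < r ^ n"
    using real_arch_pow by blast
  moreover have "q (P * Q) ^ n \<le> 2 * (q P * q Q) ^ n"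
    using spectral_norm_mult_le_weak[of "P ^ n" "Q ^ n"]
    by (simp add: power_mult_distrib flip: spectral_norm_power)
  hence "r ^ n \<le> 2"
    using pos by (simp add: r_def power_divide divide_le_eq)
  ultimately show False by simp
qed

text \<open>
  Each commutator has two terms and so at most doubles the bound, while the total power of \<open>P\<close> grows by one.
\<close>

lemma spectral_norm_iterated_commutator_le:
  assumes "0 \<le> K" and "\<And>l. l \<le> n \<Longrightarrow> q (L (P ^ l)) \<le> K * q P ^ l"
  shows "j + k \<le> n \<Longrightarrow> q (iterated_commutator L P k (P ^ j)) \<le> 2 ^ k * K * q P ^ (j + k)"
proof (induction k arbitrary: j)
  case 0
  thus ?case using assms by simp
next
  case (Suc k)
  note norm = spectral_norm_imp_poly_norm
  have "q (iterated_commutator L P (Suc k) (P ^ j)) \<le>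
        q (iterated_commutator L P k (P ^ Suc j)) + q (P * iterated_commutator L P k (P ^ j))"
    using poly_norm_triangle_diff[OF norm] by simp
  also have "\<dots> \<le> 2 ^ k * K * q P ^ (Suc j + k) + q P * (2 ^ k * K * q P ^ (j + k))"
    using Suc.prems
    by (intro add_mono Suc.IH order_trans[OF spectral_norm_mult_le] mult_left_mono
          poly_norm_nonneg[OF norm]) auto
  also have "\<dots> = 2 ^ Suc k * K * q P ^ (j + Suc k)"
    by (simp add: algebra_simps)
  finally show ?case .
qed

end

section \<open>Exponents in Markov's inequality\<close>

text \<open>
  The exponents over which the infimum in \<open>deriv_exponent\<close> is taken.
\<close>

definition admissible_exponent :: "'n::finite multi_index \<Rightarrow> ('n cpoly \<Rightarrow> real) \<Rightarrow> real \<Rightarrow> bool" where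
  "admissible_exponent \<alpha> q s \<longleftrightarrow>
     0 < s \<and> (\<exists>M>0. \<forall>P. q (multi_deriv \<alpha> P) \<le> M * real (total_degree P) powr s * q P)"

lemma deriv_exponent_eq: "deriv_exponent \<alpha> q = (INF s\<in>Collect (admissible_exponent \<alpha> q). ereal s)"
  by (simp add: deriv_exponent_def admissible_exponent_def[abs_def])

lemma admissible_exponent_single_iff:
  "admissible_exponent (Poly_Mapping.single j 1) q s \<longleftrightarrow>
     0 < s \<and> (\<exists>M>0. \<forall>P. q (partial_deriv j P) \<le> M * real (total_degree P) powr s * q P)"
  unfolding admissible_exponent_def multi_deriv_single ..

lemma deriv_exponent_le: "admissible_exponent \<alpha> q s \<Longrightarrow> deriv_exponent \<alpha> q \<le> ereal s"
  by (simp add: deriv_exponent_eq INF_lower)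

lemma deriv_exponent_nonneg: "0 \<le> deriv_exponent \<alpha> q"
  unfolding deriv_exponent_eq by (rule INF_greatest) (auto simp: admissible_exponent_def)

text \<open>
  At degree \<open>0\<close> both sides vanish, because \<open>0 powr s = 0\<close> for every \<open>s\<close>.
\<close>

lemma real_powr_mono_exponent: "s \<le> t \<Longrightarrow> real n powr s \<le> real n powr t"
  by (cases "n = 0") (auto intro: powr_mono)

lemma admissible_exponent_mono:
  assumes "\<And>P. 0 \<le> q P" and "admissible_exponent \<alpha> q s" "s \<le> t"
  shows "admissible_exponent \<alpha> q t"
proof -
  obtain M where M: "M > 0" "\<And>P. q (multi_deriv \<alpha> P) \<le> M * real (total_degree P) powr s * q P"
    and "0 < s"
    using assms(2) by (auto simp: admissible_exponent_def)
  have "q (multi_deriv \<alpha> P) \<le> M * real (total_degree P) powr t * q P" for P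
    by (rule order_trans[OF M(2)])
       (use M(1) assms(1,3) in \<open>intro mult_mono order_refl real_powr_mono_exponent mult_nonneg_nonneg; simp\<close>)
  with M(1) \<open>0 < s\<close> assms(3) show ?thesis
    unfolding admissible_exponent_def by auto
qed

lemma admissible_exponent_if_deriv_exponent_less:
  assumes "\<And>P. 0 \<le> q P" and "deriv_exponent \<alpha> q < ereal t"
  shows "admissible_exponent \<alpha> q t"
proof -
  obtain s where "admissible_exponent \<alpha> q s" "s < t"
    using assms(2) by (auto simp: deriv_exponent_eq INF_less_iff)
  thus ?thesis using admissible_exponent_mono[of q \<alpha> s t] assms(1) by simp
qed

lemma kth_exponent_le_iff:
  "kth_exponent k q \<le> x \<longleftrightarrow> (\<forall>\<alpha>. mi_abs \<alpha> = k \<longrightarrow> deriv_exponent \<alpha> q \<le> x)"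
proof -
  have eq: "{deriv_exponent \<alpha> q |\<alpha>. mi_abs \<alpha> = k} = (\<lambda>\<alpha>. deriv_exponent \<alpha> q) ` {\<alpha>. mi_abs \<alpha> = k}"
    by auto
  have "{\<alpha>. mi_abs \<alpha> = k} \<noteq> {}"
    using mi_abs_single[of undefined k] by blast
  thus ?thesis
    unfolding kth_exponent_def eq by (subst Max_le_iff) (auto simp: finite_multi_indices)
qed

lemma deriv_exponent_le_kth_exponent: "deriv_exponent \<alpha> q \<le> kth_exponent (mi_abs \<alpha>) q"
  using kth_exponent_le_iff[of "mi_abs \<alpha>" q "kth_exponent (mi_abs \<alpha>) q"] by auto

lemma kth_exponent_nonneg: "0 \<le> kth_exponent k q"
  using order_trans[OF deriv_exponent_nonneg deriv_exponent_le_kth_exponent, of "Poly_Mapping.single undefined k" q]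
  by simp

lemma markov_exponent_le_iff:
  "markov_exponent q \<le> x \<longleftrightarrow> (\<forall>j. deriv_exponent (Poly_Mapping.single j 1) q \<le> x)"
  unfolding markov_exponent_def kth_exponent_le_iff
  by (metis mi_abs_1E mi_abs_single)

lemma markov_inequality_mono:
  assumes "\<And>P. 0 \<le> q P" "0 \<le> M" "markov_inequality q M s" "s \<le> t"
  shows "markov_inequality q M t"
  unfolding markov_inequality_def
proof (intro allI)
  fix j P
  have "M * real (total_degree P) powr s * q P \<le> M * real (total_degree P) powr t * q P"
    using assms(1,2,4)
    by (intro mult_mono order_refl real_powr_mono_exponent mult_nonneg_nonneg; simp)
  thus "q (partial_deriv j P) \<le> M * real (total_degree P) powr t * q P"
    using assms(3) by (meson markov_inequality_def order_trans)
qed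

lemma admissible_exponent_imp_markov_inequality:
  fixes q :: "'n::finite cpoly \<Rightarrow> real"
  assumes "\<And>P. 0 \<le> q P" and "\<And>j. admissible_exponent (Poly_Mapping.single j 1) q s"
  obtains M where "0 < M" "markov_inequality q M s"
proof -
  have "\<forall>j. \<exists>M>0. \<forall>P. q (partial_deriv j P) \<le> M * real (total_degree P) powr s * q P"
    using assms(2) unfolding admissible_exponent_single_iff by blast
  then obtain M where M: "\<And>j. M j > 0"
      "\<And>j P. q (partial_deriv j P) \<le> M j * real (total_degree P) powr s * q P"
    by metis
  have le: "M j \<le> sum M UNIV" for j
    by (rule member_le_sum) (use M(1) less_imp_le in auto)
  show thesis
  proof
    show "0 < sum M UNIV"
      using le[of undefined] M(1)[of undefined] by linarith
    show "markov_inequality q (sum M UNIV) s"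
      unfolding markov_inequality_def
      by (intro allI order_trans[OF M(2)] mult_right_mono le) (auto simp: assms(1))
  qed
qed

lemma markov_inequality_imp_markov_exponent_le:
  assumes "0 < M" "markov_inequality q M s" "0 < s"
  shows "markov_exponent q \<le> ereal s"
proof -
  have "admissible_exponent (Poly_Mapping.single j 1) q s" for j
    unfolding admissible_exponent_single_iff using assms by (auto simp: markov_inequality_def)
  thus ?thesis
    using markov_exponent_le_iff deriv_exponent_le by blast
qed

text \<open>
  The factor is kept in the form \<open>(M n\<^sup>s)\<^sup>k\<close> rather than \<open>M\<^sup>k n\<^sup>s\<^sup>k\<close>: it is then correct also for \<open>k = 0\<close> and \<open>n = 0\<close>,
  where the second form would be \<open>0\<close>.
\<close>

lemma markov_inequality_multi_deriv:
  assumes "\<And>P. 0 \<le> q P" "0 \<le> M" "0 \<le> s" "markov_inequality q M s"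
  shows "q (multi_deriv \<alpha> P) \<le> (M * real (total_degree P) powr s) ^ mi_abs \<alpha> * q P"
proof (induction "mi_abs \<alpha>" arbitrary: \<alpha>)
  case 0
  hence "\<alpha> = 0" by (simp add: mi_abs_eq_0_iff)
  thus ?case by (simp add: mi_abs_def)
next
  case (Suc k)
  from Suc.hyps(2)[symmetric] obtain \<beta> j
    where \<alpha>: "\<alpha> = \<beta> + Poly_Mapping.single j 1" and \<beta>: "mi_abs \<beta> = k" by (rule mi_abs_SucE)
  have "q (multi_deriv \<alpha> P) \<le> M * real (total_degree (multi_deriv \<beta> P)) powr s * q (multi_deriv \<beta> P)"
    using assms(4) unfolding \<alpha> multi_deriv_add_single by (simp add: markov_inequality_def)
  also have "\<dots> \<le> (M * real (total_degree P) powr s) *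
               ((M * real (total_degree P) powr s) ^ k * q P)"
    using Suc.hyps(1)[of \<beta>] \<beta> assms(1-3) total_degree_multi_deriv_le[of \<beta> P]
    by (intro mult_mono mult_left_mono powr_mono2) auto
  also have "\<dots> = (M * real (total_degree P) powr s) ^ mi_abs \<alpha> * q P"
    unfolding Suc.hyps(2)[symmetric] by simp
  finally show ?case .
qed

theorem kth_exponent_le_markov_exponent:
  fixes q :: "'n::finite cpoly \<Rightarrow> real"
  assumes nonneg: "\<And>P. 0 \<le> q P" and k: "k \<ge> 1"
  shows "kth_exponent k q \<le> ereal (real k) * markov_exponent q"
proof -
  have *: "kth_exponent k q \<le> ereal (real k * t)" if t: "markov_exponent q < ereal t" for t
  proof -
    have tpos: "0 < t"
      using order_le_less_trans[OF kth_exponent_nonneg[of 1 q] t[unfolded markov_exponent_def]] by simp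
    have "deriv_exponent (Poly_Mapping.single j 1) q < ereal t" for j
      using t markov_exponent_le_iff[of q "markov_exponent q"] by (meson order.refl order_le_less_trans)
    hence "admissible_exponent (Poly_Mapping.single j 1) q t" for j
      using admissible_exponent_if_deriv_exponent_less[of q, OF nonneg] by blast
    then obtain M where M: "0 < M" "markov_inequality q M t"
      using admissible_exponent_imp_markov_inequality[of q, OF nonneg] by blast
    have "admissible_exponent \<alpha> q (real k * t)" if \<alpha>: "mi_abs \<alpha> = k" for \<alpha> :: "'n multi_index"
      unfolding admissible_exponent_def
    proof (intro conjI exI[of _ "M ^ k"] allI)
      fix P :: "'n cpoly"
      have "(real (total_degree P) powr t) ^ k = real (total_degree P) powr (real k * t)"
        using k by (cases "total_degree P = 0") (auto simp: powr_power mult.commute)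
      thus "q (multi_deriv \<alpha> P) \<le> M ^ k * real (total_degree P) powr (real k * t) * q P"
        using markov_inequality_multi_deriv[OF nonneg _ _ M(2), of \<alpha> P] M(1) tpos \<alpha>
        by (simp add: power_mult_distrib)
    qed (use M(1) tpos k in auto)
    thus ?thesis
      unfolding kth_exponent_le_iff using deriv_exponent_le by blast
  qed
  show ?thesis
  proof (cases "markov_exponent q")
    case (real r)
    show ?thesis unfolding real
    proof (rule ereal_le_epsilon2)
      fix e :: real assume "0 < e"
      have "kth_exponent k q \<le> ereal (real k * (r + e / real k))"
        using \<open>0 < e\<close> k by (intro *) (simp add: real)
      also have "real k * (r + e / real k) = real k * r + e"
        using k by (simp add: field_simps)
      finally show "kth_exponent k q \<le> ereal (real k) * ereal r + ereal e"
        by simp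
    qed
  qed (use k kth_exponent_nonneg[of 1 q] in \<open>auto simp: markov_exponent_def\<close>)
qed

text \<open>
  The derivative of order \<open>k\<close>, applied to the powers \<open>P\<^sup>l\<close> with \<open>l \<le> k\<close>, controls the commutator
  \<open>k! (D P)\<^sup>k\<close>. Since \<open>q((D P)\<^sup>k) = q(D P)\<^sup>k\<close>, a \<open>k\<close>-th root gives an inequality of first order.
\<close>

lemma admissible_exponent_spectral_root:
  assumes spectral: "spectral_norm q" and k: "k \<ge> 1" and s: "admissible_exponent (Poly_Mapping.single j k) q s"
  shows "admissible_exponent (Poly_Mapping.single j 1) q (s / real k)"
proof -
  note norm = spectral_norm_imp_poly_norm[OF spectral]
  note nonneg = poly_norm_nonneg[OF norm]
  let ?D = "partial_deriv j"
  obtain M where M: "M > 0" "\<And>P. q ((?D ^^ k) P) \<le> M * real (total_degree P) powr s * q P"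
    and spos: "0 < s"
    using s by (auto simp: admissible_exponent_def multi_deriv_single_power)
  define C where "C = 2 * root k (M * real k powr s)"
  have Cpos: "0 < C"
    using M(1) k by (simp add: C_def)
  have "q (?D P) \<le> C * real (total_degree P) powr (s / real k) * q P" for P
  proof -
    define n where "n = total_degree P"
    define K where "K = M * (real k * real n) powr s"
    have K0: "0 \<le> K" using M(1) by (simp add: K_def)
    have "q ((?D ^^ k) (P ^ l)) \<le> K * q P ^ l" if "l \<le> k" for l
    proof -
      have "real (total_degree (P ^ l)) \<le> real k * real n"
        using order_trans[OF total_degree_power_le[of P l] mult_le_mono1[OF that]]
        by (simp add: n_def flip: of_nat_mult)
      thus ?thesis
        unfolding K_def using M(1) spos nonneg
        by (intro order_trans[OF M(2)])
           (auto simp: spectral_norm_power[OF spectral] intro!: mult_mono powr_mono2 mult_nonneg_nonneg)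
    qed
    from spectral_norm_iterated_commutator_le[OF spectral K0 this, of k 0 k]
    have "q (iterated_commutator (?D ^^ k) P k 1) \<le> 2 ^ k * K * q P ^ k"
      by simp
    also have "iterated_commutator (?D ^^ k) P k 1 = of_nat (fact k) * ?D P ^ k"
      using iterated_commutator_higher_derivation[of ?D k k P 1, OF partial_deriv_diff partial_deriv_mult]
      by (simp del: of_nat_fact)
    finally have "fact k * q (?D P) ^ k \<le> 2 ^ k * K * q P ^ k"
      unfolding poly_norm_of_nat_mult[OF norm] spectral_norm_power[OF spectral] by simp
    moreover have "1 * q (?D P) ^ k \<le> fact k * q (?D P) ^ k"
      using nonneg by (intro mult_right_mono) (auto simp: fact_ge_1)
    ultimately have "q (?D P) ^ k \<le> 2 ^ k * K * q P ^ k" by linarith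
    also have "2 ^ k * K * q P ^ k = (C * real n powr (s / real k) * q P) ^ k"
    proof -
      have "(real n powr (s / real k)) ^ k = real n powr s"
        using k by (cases "n = 0") (auto simp: powr_power)
      moreover have "root k (M * real k powr s) ^ k = M * real k powr s"
        using k M(1) by (intro real_root_pow_pos2) auto
      ultimately show ?thesis
        by (simp add: C_def K_def power_mult_distrib powr_mult)
    qed
    finally have "q (?D P) ^ Suc (k - 1) \<le> (C * real n powr (s / real k) * q P) ^ Suc (k - 1)"
      using k by simp
    thus ?thesis
      unfolding n_def by (rule power_le_imp_le_base) (use nonneg Cpos in auto)
  qed
  thus ?thesis
    unfolding admissible_exponent_single_iff using Cpos spos k by auto
qed

theorem markov_exponent_le_kth_exponent_spectral:
  assumes "spectral_norm q" and k: "k \<ge> 1"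
  shows "ereal (real k) * markov_exponent q \<le> kth_exponent k q"
proof -
  have "ereal (real k) * deriv_exponent (Poly_Mapping.single j 1) q \<le>
        deriv_exponent (Poly_Mapping.single j k) q" for j
    unfolding deriv_exponent_eq[of "Poly_Mapping.single j k"]
  proof (rule INF_greatest)
    fix s assume "s \<in> Collect (admissible_exponent (Poly_Mapping.single j k) q)"
    hence "deriv_exponent (Poly_Mapping.single j 1) q \<le> ereal (s / real k)"
      using admissible_exponent_spectral_root[OF assms] deriv_exponent_le by blast
    hence "ereal (real k) * deriv_exponent (Poly_Mapping.single j 1) q \<le>
        ereal (real k) * ereal (s / real k)"
      by (intro ereal_mult_left_mono) auto
    thus "ereal (real k) * deriv_exponent (Poly_Mapping.single j 1) q \<le> ereal s"
      using k by simp
  qed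
  moreover have "deriv_exponent (Poly_Mapping.single j k) q \<le> kth_exponent k q" for j
    using deriv_exponent_le_kth_exponent[of "Poly_Mapping.single j k" q] by simp
  ultimately have "ereal (real k) * deriv_exponent (Poly_Mapping.single j 1) q \<le> kth_exponent k q" for j
    by (meson order_trans)
  hence "deriv_exponent (Poly_Mapping.single j 1) q \<le> kth_exponent k q / ereal (real k)" for j
    using k by (simp add: ereal_le_divide_pos)
  hence "markov_exponent q \<le> kth_exponent k q / ereal (real k)"
    by (simp add: markov_exponent_le_iff)
  thus ?thesis using k by (simp add: ereal_le_divide_pos)
qed

section \<open>Norms with the generalized Nikolskii property\<close>

text \<open>
  One half of the Nikolskii property. The factor \<open>max 1 (deg P)\<close> makes it meaningful for constants, which occur
  as derivatives of nonconstant polynomials.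
\<close>

definition nikolskii_dominated ::
    "real \<Rightarrow> real \<Rightarrow> ('n::finite cpoly \<Rightarrow> real) \<Rightarrow> ('n cpoly \<Rightarrow> real) \<Rightarrow> bool" where
  "nikolskii_dominated C c q q' \<longleftrightarrow>
     0 < C \<and> 0 \<le> c \<and> (\<forall>P. q P \<le> C * real (max 1 (total_degree P)) powr c * q' P)"

text \<open>
  On the constants the two norms are proportional, which takes care of degree \<open>0\<close>.
\<close>

lemma nikolskii_dominatedI:
  assumes q: "poly_norm q" and q': "poly_norm q'" and "0 < A" "0 \<le> a"
    and le: "\<And>P. 1 \<le> total_degree P \<Longrightarrow> q P \<le> A * real (total_degree P) powr a * q' P"
  obtains C where "nikolskii_dominated C a q q'"
proof
  define C where "C = A + q 1 / q' 1"
  have C: "A \<le> C" "q 1 / q' 1 \<le> C" "0 < C"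
    using \<open>0 < A\<close> poly_norm_one_pos[OF q] poly_norm_one_pos[OF q'] by (simp_all add: C_def add_pos_pos)
  have "q P \<le> C * real (max 1 (total_degree P)) powr a * q' P" for P
  proof (cases "total_degree P = 0")
    case True
    then obtain c where P: "P = Poly_Mapping.single 0 c"
      using total_degree_eq_0D by blast
    have "q P = q 1 / q' 1 * q' P"
      using poly_norm_one_pos[OF q'] by (simp add: P poly_norm_const[OF q] poly_norm_const[OF q'])
    also have "\<dots> \<le> C * q' P"
      using C(2) poly_norm_nonneg[OF q'] by (rule mult_right_mono)
    finally show ?thesis using True by simp
  next
    case False
    hence "q P \<le> A * real (max 1 (total_degree P)) powr a * q' P"
      using le[of P] by (simp add: max_def)
    also have "\<dots> \<le> C * real (max 1 (total_degree P)) powr a * q' P"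
      using C(1) poly_norm_nonneg[OF q'] by (intro mult_right_mono) auto
    finally show ?thesis .
  qed
  thus "nikolskii_dominated C a q q'"
    using C(3) \<open>0 \<le> a\<close> by (simp add: nikolskii_dominated_def)
qed

lemma generalized_nikolskiiE:
  assumes "generalized_nikolskii q q\<^sub>\<sigma>"
  obtains A a B b where "nikolskii_dominated A a q\<^sub>\<sigma> q" "nikolskii_dominated B b q q\<^sub>\<sigma>"
proof -
  obtain A B a b where *: "0 < A" "0 < B" "0 \<le> a" "0 \<le> b"
      "\<And>P. 1 \<le> total_degree P \<Longrightarrow> q\<^sub>\<sigma> P \<le> A * real (total_degree P) powr a * q P"
      "\<And>P. 1 \<le> total_degree P \<Longrightarrow> q P \<le> B * real (total_degree P) powr b * q\<^sub>\<sigma> P"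
    and norms: "poly_norm q" "poly_norm q\<^sub>\<sigma>"
    using assms spectral_norm_imp_poly_norm unfolding generalized_nikolskii_def by blast
  show thesis
    using nikolskii_dominatedI[OF norms *(2,4,6)] nikolskii_dominatedI[OF norms(2,1) *(1,3,5)] that
    by metis
qed

text \<open>
  Passing from \<open>q\<close> to \<open>q'\<close> before the inequality and back afterwards costs the factors \<open>n\<^sup>a\<close> and \<open>n\<^sup>b\<close>, because
  differentiation does not raise the degree \<open>n\<close>.
\<close>

lemma kth_exponent_le_dominated:
  assumes nonneg: "\<And>P. 0 \<le> q P" "\<And>P. 0 \<le> q' P"
    and qq': "nikolskii_dominated A a q q'" and q'q: "nikolskii_dominated B b q' q"
  shows "kth_exponent k q \<le> kth_exponent k q' + ereal (a + b)"
proof -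
  have A: "0 < A" "0 \<le> a" "\<And>P. q P \<le> A * real (max 1 (total_degree P)) powr a * q' P"
    and B: "0 < B" "0 \<le> b" "\<And>P. q' P \<le> B * real (max 1 (total_degree P)) powr b * q P"
    using qq' q'q by (auto simp: nikolskii_dominated_def)
  have transfer: "admissible_exponent \<alpha> q (s + (a + b))" if ms: "admissible_exponent \<alpha> q' s" for \<alpha> s
  proof -
    obtain M where s: "0 < s" and M: "M > 0"
        "\<And>P. q' (multi_deriv \<alpha> P) \<le> M * real (total_degree P) powr s * q' P"
      using ms unfolding admissible_exponent_def by blast
    have "q (multi_deriv \<alpha> P) \<le> (A * M * B) * real (total_degree P) powr (s + (a + b)) * q P" for P
    proof -
      define n where "n = total_degree P"
      define n' where "n' = total_degree (multi_deriv \<alpha> P)"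
      have n': "n' \<le> n"
        unfolding n_def n'_def by (rule total_degree_multi_deriv_le)
      have "q (multi_deriv \<alpha> P) \<le> A * real (max 1 n') powr a * q' (multi_deriv \<alpha> P)"
        unfolding n'_def by (rule A)
      also have "\<dots> \<le> A * real (max 1 n) powr a * (M * real n powr s * (B * real (max 1 n) powr b * q P))"
      proof (intro mult_mono)
        show "q' (multi_deriv \<alpha> P) \<le> M * real n powr s * (B * real (max 1 n) powr b * q P)"
          unfolding n_def using M(1) by (intro order_trans[OF M(2)] mult_left_mono B) auto
      qed (use A(1,2) n' nonneg in \<open>auto intro!: powr_mono2\<close>)
      also have "\<dots> = (A * M * B) * real n powr (s + (a + b)) * q P"
        by (cases "n = 0") (auto simp: powr_add max_def)
      finally show ?thesis by (simp only: n_def)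
    qed
    thus ?thesis
      unfolding admissible_exponent_def using A B M(1) s by (intro conjI exI[of _ "A * M * B"]) auto
  qed
  have "deriv_exponent \<alpha> q \<le> deriv_exponent \<alpha> q' + ereal (a + b)" for \<alpha>
  proof -
    have "deriv_exponent \<alpha> q - ereal (a + b) \<le> deriv_exponent \<alpha> q'"
      unfolding deriv_exponent_eq[of \<alpha> q']
    proof (rule INF_greatest)
      fix s assume "s \<in> Collect (admissible_exponent \<alpha> q')"
      hence "deriv_exponent \<alpha> q \<le> ereal s + ereal (a + b)"
        using deriv_exponent_le[OF transfer] by simp
      thus "deriv_exponent \<alpha> q - ereal (a + b) \<le> ereal s"
        by (simp add: ereal_minus_le)
    qed
    thus ?thesis by (simp add: ereal_minus_le)
  qed
  moreover have "deriv_exponent \<alpha> q' + ereal (a + b) \<le> kth_exponent (mi_abs \<alpha>) q' + ereal (a + b)" for \<alpha>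
    by (intro add_right_mono deriv_exponent_le_kth_exponent)
  ultimately show ?thesis
    unfolding kth_exponent_le_iff using order_trans by blast
qed

lemma tendsto_add_const_over_n:
  "(\<lambda>k. x + ereal (c / real k)) \<longlonglongrightarrow> x"
proof -
  have "(\<lambda>k. c / real k) \<longlonglongrightarrow> 0"
    by (rule lim_const_over_n)
  hence "(\<lambda>k. ereal (c / real k)) \<longlonglongrightarrow> ereal 0"
    by (simp only: lim_ereal)
  hence "(\<lambda>k. x + ereal (c / real k)) \<longlonglongrightarrow> x + ereal 0"
    by (intro tendsto_add_ereal_general tendsto_const) auto
  thus ?thesis by simp
qed

lemma ereal_mult_inverse_nat:
  assumes "k \<ge> 1"
  shows "ereal (1 / real k) * (ereal (real k) * x) = x"
  using assms by (cases x) (auto simp: divide_simps)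

text \<open>
  All \<open>m\<^sub>k(q)\<close> lie within a fixed distance \<open>c\<close> of \<open>m\<^sub>k(q\<^sub>\<sigma>) = k m(q\<^sub>\<sigma>)\<close>.
\<close>

theorem kth_exponent_tendsto:
  assumes nik: "generalized_nikolskii q q\<^sub>\<sigma>"
  shows "(\<lambda>k. ereal (1 / real k) * kth_exponent k q) \<longlonglongrightarrow> markov_exponent q\<^sub>\<sigma>"
proof -
  have norm: "poly_norm q" and spectral: "spectral_norm q\<^sub>\<sigma>"
    using nik by (auto simp: generalized_nikolskii_def)
  note nonneg = poly_norm_nonneg[OF norm] poly_norm_nonneg[OF spectral_norm_imp_poly_norm[OF spectral]]
  obtain A a B b where dom: "nikolskii_dominated A a q\<^sub>\<sigma> q" "nikolskii_dominated B b q q\<^sub>\<sigma>"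
    using generalized_nikolskiiE[OF nik] .
  define c where "c = a + b"
  let ?m = "markov_exponent q\<^sub>\<sigma>"
  have upper: "ereal (1 / real k) * kth_exponent k q \<le> ?m + ereal (c / real k)" if k: "k \<ge> 1" for k
  proof -
    have "kth_exponent k q \<le> kth_exponent k q\<^sub>\<sigma> + ereal (b + a)"
      by (rule kth_exponent_le_dominated[OF nonneg dom(2,1)])
    also have "\<dots> \<le> ereal (real k) * ?m + ereal (b + a)"
      by (intro add_right_mono kth_exponent_le_markov_exponent nonneg k)
    also have "\<dots> = ereal (real k) * (?m + ereal (c / real k))"
      using k by (cases ?m) (auto simp: c_def field_simps)
    finally have "ereal (1 / real k) * kth_exponent k q \<le>
        ereal (1 / real k) * (ereal (real k) * (?m + ereal (c / real k)))"
      by (intro ereal_mult_left_mono) auto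
    thus ?thesis by (simp only: ereal_mult_inverse_nat[OF k])
  qed
  have lower: "?m + ereal (- c / real k) \<le> ereal (1 / real k) * kth_exponent k q" if k: "k \<ge> 1" for k
  proof -
    have "ereal (real k) * ?m \<le> kth_exponent k q\<^sub>\<sigma>"
      by (rule markov_exponent_le_kth_exponent_spectral[OF spectral k])
    also have "\<dots> \<le> kth_exponent k q + ereal c"
      unfolding c_def by (rule kth_exponent_le_dominated[OF nonneg(2,1) dom])
    finally have "ereal (1 / real k) * (ereal (real k) * ?m) \<le> ereal (1 / real k) * (kth_exponent k q + ereal c)"
      by (intro ereal_mult_left_mono) auto
    hence "?m \<le> ereal (1 / real k) * (kth_exponent k q + ereal c)"
      by (simp only: ereal_mult_inverse_nat[OF k])
    also have "\<dots> = ereal (1 / real k) * kth_exponent k q + ereal (c / real k)"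
      using k kth_exponent_nonneg[of k q] by (cases "kth_exponent k q") (auto simp: field_simps)
    finally show ?thesis
      using k kth_exponent_nonneg[of k q]
      by (cases "ereal (1 / real k) * kth_exponent k q"; cases ?m) auto
  qed
  show ?thesis
    by (rule tendsto_sandwich[OF _ _ tendsto_add_const_over_n[of ?m "-c"] tendsto_add_const_over_n[of ?m c]])
       (use upper lower in \<open>auto intro!: eventually_sequentiallyI[of 1]\<close>)
qed

corollary asymptotic_exponent_eq_markov_exponent_spectral:
  assumes "generalized_nikolskii q q\<^sub>\<sigma>"
  shows "asymptotic_exponent q = markov_exponent q\<^sub>\<sigma>"
  unfolding asymptotic_exponent_def
  by (rule lim_imp_Limsup[OF _ kth_exponent_tendsto[OF assms]]) simp

corollary markov_exponent_spectral_le: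
  assumes nik: "generalized_nikolskii q q\<^sub>\<sigma>"
  shows "markov_exponent q\<^sub>\<sigma> \<le> markov_exponent q"
proof -
  have nonneg: "0 \<le> q P" for P
    using nik poly_norm_nonneg by (auto simp: generalized_nikolskii_def)
  have "ereal (1 / real k) * kth_exponent k q \<le> markov_exponent q" if k: "k \<ge> 1" for k
  proof -
    have "ereal (1 / real k) * kth_exponent k q \<le> ereal (1 / real k) * (ereal (real k) * markov_exponent q)"
      by (intro ereal_mult_left_mono kth_exponent_le_markov_exponent nonneg k) auto
    thus ?thesis by (simp only: ereal_mult_inverse_nat[OF k])
  qed
  thus ?thesis
    by (intro tendsto_upperbound[OF kth_exponent_tendsto[OF nik]])
       (auto intro!: eventually_sequentiallyI[of 1])
qed

text \<open>
  If \<open>s \<le> 0\<close>, then every partial derivative is bounded by \<open>M\<close> in the norm \<open>q\<close>. Testing the \<open>k\<close>-th derivative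
  on \<open>x\<^sub>j\<^sup>k\<close>, whose norm grows at most geometrically by the comparison with \<open>q\<^sub>\<sigma>\<close>, contradicts the growth of \<open>k!\<close>.
\<close>

lemma markov_inequality_exponent_pos:
  fixes q :: "'n::finite cpoly \<Rightarrow> real"
  assumes nik: "generalized_nikolskii q q\<^sub>\<sigma>" and M: "0 < M" "markov_inequality q M s"
  shows "0 < s"
proof (rule ccontr)
  assume "\<not> 0 < s"
  have norm: "poly_norm q" and spectral: "spectral_norm q\<^sub>\<sigma>"
    using nik by (auto simp: generalized_nikolskii_def)
  note nonneg = poly_norm_nonneg[OF norm]
  note nonneg' = poly_norm_nonneg[OF spectral_norm_imp_poly_norm[OF spectral]]
  have M0: "markov_inequality q M 0"
    using markov_inequality_mono[of q M s 0] nonneg M \<open>\<not> 0 < s\<close> by simp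
  obtain B b where B: "0 < B" "0 \<le> b" "\<And>P. q P \<le> B * real (max 1 (total_degree P)) powr b * q\<^sub>\<sigma> P"
    using generalized_nikolskiiE[OF nik] by (metis nikolskii_dominated_def)
  define x where "x = Poly_Mapping.single (Poly_Mapping.single (undefined :: 'n) (1::nat)) (1::complex)"
  have deg: "total_degree (x ^ k) \<le> k" for k
    using total_degree_power_le[of x k] by (simp add: x_def total_degree_def)
  have grow: "real (max 1 k) powr b \<le> (2 powr b) ^ k" for k
  proof -
    have "real (max 1 k) \<le> 2 ^ k"
      using less_exp[of k] by (simp add: max_def)
    hence "real (max 1 k) powr b \<le> (2 ^ k) powr b"
      using B(2) by (intro powr_mono2) auto
    also have "(2 ^ k) powr b = (2 powr b) ^ k"
      by (simp add: powr_powr mult.commute flip: powr_realpow powr_power)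
    finally show ?thesis .
  qed
  \<comment> \<open>the ratio of the geometric bound; the factor \<open>2 powr b\<close> absorbs the Nikolskii factor \<open>k powr b\<close>\<close>
  define z where "z = M * 2 powr b * q\<^sub>\<sigma> x"
  have bound: "fact k * q 1 \<le> B * z ^ k" for k
  proof -
    have "fact k * q 1 = q (multi_deriv (Poly_Mapping.single undefined k) (x ^ k))"
      unfolding multi_deriv_single_power x_def higher_partial_deriv_var_power poly_norm_const[OF norm]
      by simp
    also have "\<dots> \<le> (M * real (total_degree (x ^ k)) powr 0) ^ k * q (x ^ k)"
      using markov_inequality_multi_deriv[of q M 0 "Poly_Mapping.single undefined k" "x ^ k"] nonneg M(1) M0
      by simp
    also have "\<dots> \<le> M ^ k * q (x ^ k)"
      using M(1) nonneg by (intro mult_right_mono power_mono) auto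
    also have "\<dots> \<le> M ^ k * (B * (2 powr b) ^ k * q\<^sub>\<sigma> (x ^ k))"
    proof (intro mult_left_mono order_trans[OF B(3)] mult_right_mono)
      have "real (max 1 (total_degree (x ^ k))) powr b \<le> real (max 1 k) powr b"
        using deg[of k] B(2) by (intro powr_mono2) auto
      thus "real (max 1 (total_degree (x ^ k))) powr b \<le> (2 powr b) ^ k"
        using grow by (rule order_trans)
    qed (use M(1) B(1) nonneg' in auto)
    finally show ?thesis
      by (simp add: z_def power_mult_distrib spectral_norm_power[OF spectral] mult_ac)
  qed
  have "(\<lambda>k. z ^ k / fact k) \<longlonglongrightarrow> 0"
    using summable_LIMSEQ_zero[OF summable_exp[of z]] by (simp add: field_simps)
  hence "(\<lambda>k. B * (z ^ k / fact k)) \<longlonglongrightarrow> B * 0"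
    by (intro tendsto_intros)
  moreover have "q 1 \<le> B * (z ^ k / fact k)" for k
    using bound[of k] by (simp add: field_simps)
  ultimately have "q 1 \<le> B * 0"
    by (intro tendsto_lowerbound) auto
  thus False using poly_norm_one_pos[OF norm] by simp
qed

section \<open>Evaluation of polynomials\<close>

lemma eval_poly_eq_sum:
  assumes "finite S" "Poly_Mapping.keys P \<subseteq> S"
  shows "eval_poly P x =
     (\<Sum>\<alpha>\<in>S. Poly_Mapping.lookup P \<alpha> * (\<Prod>i\<in>UNIV. (x $ i) ^ Poly_Mapping.lookup \<alpha> i))"
  unfolding eval_poly_def using assms by (intro sum.mono_neutral_left) (auto simp: in_keys_iff)

lemma eval_poly_single:
  "eval_poly (Poly_Mapping.single \<alpha> c) x = c * (\<Prod>i\<in>UNIV. (x $ i) ^ Poly_Mapping.lookup \<alpha> i)"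
  by (subst eval_poly_eq_sum[of "{\<alpha>}"]) auto

lemma eval_poly_const [simp]: "eval_poly (Poly_Mapping.single 0 c) x = c"
  by (simp add: eval_poly_single)

lemma eval_poly_zero [simp]: "eval_poly 0 x = 0"
  by (simp add: eval_poly_def)

lemma eval_poly_one [simp]: "eval_poly 1 x = 1"
  using eval_poly_const[of 1 x] by simp

lemma eval_poly_add: "eval_poly (P + Q) x = eval_poly P x + eval_poly Q x"
  using keys_add[of P Q]
  by (simp add: eval_poly_eq_sum[of "Poly_Mapping.keys P \<union> Poly_Mapping.keys Q"] lookup_add
      algebra_simps sum.distrib)

lemma eval_poly_mult: "eval_poly (P * Q) x = eval_poly P x * eval_poly Q x"
proof (induction P rule: cpoly_induct)
  case (monomial \<alpha> a)
  show ?case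
    by (induction Q rule: cpoly_induct)
       (simp_all add: mult_single eval_poly_single lookup_add power_add prod.distrib
          eval_poly_add algebra_simps)
qed (simp add: eval_poly_add algebra_simps)

lemma eval_poly_power: "eval_poly (P ^ n) x = eval_poly P x ^ n"
  by (induction n) (auto simp: eval_poly_mult)

lemma eval_poly_scale: "eval_poly (scale_poly c P) x = c * eval_poly P x"
  by (simp add: scale_poly_conv_mult eval_poly_mult)

lemma continuous_on_eval_poly: "continuous_on A (eval_poly P)"
  unfolding eval_poly_def by (intro continuous_intros)

lemma continuous_on_of_real_vec: "continuous_on A of_real_vec"
  unfolding of_real_vec_def by (intro continuous_intros)

lemma continuous_on_eval_poly_of_real_vec:
  "continuous_on A (\<lambda>x. eval_poly P (of_real_vec x))"
  by (rule continuous_on_compose2[OF continuous_on_eval_poly continuous_on_of_real_vec]) auto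

lemma eval_poly_along_curve:
  fixes c :: "'n::finite \<Rightarrow> real poly" and P :: "'n cpoly"
  assumes h: "\<And>i t. h t $ i = poly (c i) t" and d: "\<And>i. Polynomial.degree (c i) \<le> d"
    and n: "total_degree P \<le> n"
  obtains p :: "complex poly"
  where "Polynomial.degree p \<le> n * d" "\<And>t. poly p (of_real t) = eval_poly P (of_real_vec (h t))"
proof
  define C where "C i = map_poly complex_of_real (c i)" for i
  define p where "p = (\<Sum>\<alpha>\<in>Poly_Mapping.keys P.
      Polynomial.smult (Poly_Mapping.lookup P \<alpha>) (\<Prod>i\<in>UNIV. C i ^ Poly_Mapping.lookup \<alpha> i))"
  have degC: "Polynomial.degree (C i) \<le> d" for i
    unfolding C_def using d[of i] by (simp add: degree_map_poly)
  show "Polynomial.degree p \<le> n * d"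
    unfolding p_def
  proof (rule degree_sum_le)
    fix \<alpha> assume \<alpha>: "\<alpha> \<in> Poly_Mapping.keys P"
    have "Polynomial.degree (\<Prod>i\<in>UNIV. C i ^ Poly_Mapping.lookup \<alpha> i) \<le>
        (\<Sum>i\<in>UNIV. Polynomial.degree (C i ^ Poly_Mapping.lookup \<alpha> i))"
      using degree_prod_sum_le[of UNIV "\<lambda>i. C i ^ Poly_Mapping.lookup \<alpha> i"] by (simp add: o_def)
    also have "\<dots> \<le> (\<Sum>i\<in>UNIV. Poly_Mapping.lookup \<alpha> i * d)"
    proof (rule sum_mono)
      fix i
      show "Polynomial.degree (C i ^ Poly_Mapping.lookup \<alpha> i) \<le> Poly_Mapping.lookup \<alpha> i * d"
        using degree_power_le[of "C i" "Poly_Mapping.lookup \<alpha> i"] mult_le_mono1[OF degC[of i]]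
        by (metis mult.commute order_trans)
    qed
    also have "\<dots> = mi_abs \<alpha> * d"
      by (simp add: mi_abs_def sum_distrib_right)
    also have "\<dots> \<le> n * d"
      using mi_abs_le_total_degree[OF \<alpha>] n by (intro mult_le_mono1) linarith
    finally show "Polynomial.degree (Polynomial.smult (Poly_Mapping.lookup P \<alpha>)
        (\<Prod>i\<in>UNIV. C i ^ Poly_Mapping.lookup \<alpha> i)) \<le> n * d"
      using degree_smult_le order_trans by blast
  qed simp
  have "poly (C i) (of_real t) = of_real (h t $ i)" for i t
    by (simp add: C_def h poly_altdef degree_map_poly coeff_map_poly)
  thus "poly p (of_real t) = eval_poly P (of_real_vec (h t))" for t
    by (simp add: p_def eval_poly_def poly_sum poly_prod of_real_vec_def)
qed

text \<open>
  The sum is a polynomial in \<open>t\<close> with infinitely many zeros, and the sums over the fibres of \<open>e\<close> are its coefficients.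
\<close>

lemma poly_eval_sum_monomials_eq_0:
  fixes a :: "'k \<Rightarrow> 'a::{idom}"
  assumes "finite S" "infinite X" and zero: "\<And>t. t \<in> X \<Longrightarrow> (\<Sum>\<alpha>\<in>S. a \<alpha> * t ^ e \<alpha>) = 0"
  shows "(\<Sum>\<alpha>\<in>{\<alpha>\<in>S. e \<alpha> = k}. a \<alpha>) = 0"
proof -
  define p where "p = (\<Sum>\<alpha>\<in>S. Polynomial.monom (a \<alpha>) (e \<alpha>))"
  have "X \<subseteq> {t. poly p t = 0}"
    using zero by (auto simp: p_def poly_sum poly_monom)
  hence "p = 0"
    using \<open>infinite X\<close> poly_roots_finite finite_subset by blast
  hence "0 = Polynomial.coeff p k" by simp
  also have "\<dots> = (\<Sum>\<alpha>\<in>S. if e \<alpha> = k then a \<alpha> else 0)"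
    by (simp add: p_def coeff_sum)
  also have "\<dots> = (\<Sum>\<alpha>\<in>{\<alpha>\<in>S. e \<alpha> = k}. a \<alpha>)"
    using \<open>finite S\<close> by (simp add: sum.inter_filter)
  finally show ?thesis ..
qed

text \<open>
  By induction on the set \<open>A\<close> of variables that still occur: comparing coefficients in one variable \<open>x\<^sub>j\<close> splits
  \<open>S\<close> according to the exponent of \<open>x\<^sub>j\<close>. When no variable is left, the sum runs over the multi-indices that agree
  with \<open>\<beta>\<close> on all of them.
\<close>

lemma coeff_eq_0_if_eval_zero_on_box:
  fixes a :: "'n::finite multi_index \<Rightarrow> complex"
  assumes "finite A" "finite S" and X: "\<And>i. infinite (X i)"
    and zero: "\<And>x. (\<forall>i. x i \<in> X i) \<Longrightarrow>
      (\<Sum>\<alpha>\<in>S. a \<alpha> * (\<Prod>i\<in>A. x i ^ Poly_Mapping.lookup \<alpha> i)) = 0"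
  shows "(\<Sum>\<alpha>\<in>{\<alpha>\<in>S. \<forall>i\<in>A. Poly_Mapping.lookup \<alpha> i = Poly_Mapping.lookup \<beta> i}. a \<alpha>) = 0"
  using assms(1,2) zero
proof (induction A arbitrary: S)
  case empty
  have "\<exists>x. \<forall>i. x i \<in> X i"
    by (intro choice allI) (use X in \<open>metis finite.emptyI ex_in_conv\<close>)
  with empty show ?case by auto
next
  case (insert j A)
  define S' where "S' = {\<alpha>\<in>S. Poly_Mapping.lookup \<alpha> j = Poly_Mapping.lookup \<beta> j}"
  have "(\<Sum>\<alpha>\<in>S'. a \<alpha> * (\<Prod>i\<in>A. x i ^ Poly_Mapping.lookup \<alpha> i)) = 0"
    if x: "\<forall>i. x i \<in> X i" for x
    unfolding S'_def
  proof (rule poly_eval_sum_monomials_eq_0[of S "X j"])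
    fix t assume t: "t \<in> X j"
    have "(\<Prod>i\<in>A. (x(j := t)) i ^ Poly_Mapping.lookup \<alpha> i) = (\<Prod>i\<in>A. x i ^ Poly_Mapping.lookup \<alpha> i)" for \<alpha>
      using insert.hyps by (intro prod.cong) auto
    thus "(\<Sum>\<alpha>\<in>S. a \<alpha> * (\<Prod>i\<in>A. x i ^ Poly_Mapping.lookup \<alpha> i) * t ^ Poly_Mapping.lookup \<alpha> j) = 0"
      using insert.prems(2)[of "x(j := t)"] insert.hyps x t by (simp add: mult_ac)
  qed (use X insert.prems in auto)
  hence "(\<Sum>\<alpha>\<in>{\<alpha>\<in>S'. \<forall>i\<in>A. Poly_Mapping.lookup \<alpha> i = Poly_Mapping.lookup \<beta> i}. a \<alpha>) = 0"
    using insert.prems(1) by (intro insert.IH) (auto simp: S'_def)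
  thus ?case
    by (simp add: S'_def conj_ac)
qed

text \<open>
  A ball contains a cube, that is, a product of infinite sets.
\<close>

lemma cpoly_eq_0_if_vanishes_on_ball:
  fixes P :: "'n::finite cpoly"
  assumes r: "0 < r" and zero: "\<And>x. x \<in> ball y r \<Longrightarrow> eval_poly P (of_real_vec x) = 0"
  shows "P = 0"
proof (rule poly_mapping_eqI)
  fix \<beta> :: "'n multi_index"
  define e where "e = r / real (CARD('n) + 1)"
  have e: "0 < e" using r by (simp add: e_def)
  define X where "X i = complex_of_real ` {y $ i - e<..<y $ i + e}" for i
  have "infinite (X i)" for i
    using e unfolding X_def by (subst finite_image_iff) (auto simp: inj_on_def)
  moreover have "(\<Sum>\<alpha>\<in>Poly_Mapping.keys P. Poly_Mapping.lookup P \<alpha> *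
      (\<Prod>i\<in>UNIV. x i ^ Poly_Mapping.lookup \<alpha> i)) = 0" if x: "\<forall>i. x i \<in> X i" for x
  proof -
    have "\<forall>i. \<exists>u. u \<in> {y $ i - e<..<y $ i + e} \<and> x i = complex_of_real u"
      using x unfolding X_def by blast
    then obtain u where u: "\<And>i. u i \<in> {y $ i - e<..<y $ i + e}" "\<And>i. x i = complex_of_real (u i)"
      by metis
    have "norm (y - vec_lambda u) \<le> (\<Sum>i\<in>UNIV. \<bar>(y - vec_lambda u) $ i\<bar>)"
      by (rule norm_le_l1_cart)
    also have "\<dots> \<le> (\<Sum>i\<in>(UNIV :: 'n set). e)"
    proof (rule sum_mono)
      fix i
      show "\<bar>(y - vec_lambda u) $ i\<bar> \<le> e"
        using u(1)[of i] by (simp add: abs_le_iff)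
    qed
    also have "\<dots> < r"
      using r by (simp add: e_def field_simps)
    finally have "eval_poly P (of_real_vec (vec_lambda u)) = 0"
      by (intro zero) (simp add: dist_norm)
    thus ?thesis
      by (simp add: eval_poly_def of_real_vec_def u(2))
  qed
  ultimately have "(\<Sum>\<alpha>\<in>{\<alpha>\<in>Poly_Mapping.keys P. \<forall>i\<in>UNIV. Poly_Mapping.lookup \<alpha> i = Poly_Mapping.lookup \<beta> i}.
      Poly_Mapping.lookup P \<alpha>) = 0"
    by (intro coeff_eq_0_if_eval_zero_on_box[where X = X]) simp_all
  also have "{\<alpha>\<in>Poly_Mapping.keys P. \<forall>i\<in>UNIV. Poly_Mapping.lookup \<alpha> i = Poly_Mapping.lookup \<beta> i} =
      (if \<beta> \<in> Poly_Mapping.keys P then {\<beta>} else {})"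
    by (auto simp flip: poly_mapping_eq_iff fun_eq_iff)
  finally show "Poly_Mapping.lookup P \<beta> = Poly_Mapping.lookup 0 \<beta>"
    by (auto split: if_splits simp: in_keys_iff)
qed

section \<open>Univariate polynomials bounded on an interval\<close>

lemma poly_eq_sum_le:
  fixes p :: "'a::comm_ring_1 poly"
  assumes "Polynomial.degree p \<le> n"
  shows "poly p x = (\<Sum>k\<le>n. Polynomial.coeff p k * x ^ k)"
  unfolding poly_altdef using assms by (intro sum.mono_neutral_left) (auto simp: coeff_eq_0)

text \<open>
  Cauchy's estimate for the derivatives at \<open>0\<close>.
\<close>

lemma coeff_le_if_bounded_on_circle:
  fixes p :: "complex poly"
  assumes "\<And>z. cmod z = 1 \<Longrightarrow> cmod (poly p z) \<le> B"
  shows "cmod (Polynomial.coeff p k) \<le> B"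
proof -
  have "(deriv ^^ k) (poly p) = poly ((pderiv ^^ k) p)"
  proof (induction k)
    case (Suc k)
    show ?case
      by (simp add: Suc fun_eq_iff DERIV_imp_deriv poly_DERIV)
  qed simp
  hence "(deriv ^^ k) (poly p) 0 = fact k * Polynomial.coeff p k"
    by (simp add: poly_0_coeff_0 coeff_higher_pderiv pochhammer_fact)
  moreover have "cmod ((deriv ^^ k) (poly p) 0) \<le> fact k * B / 1 ^ k"
    using assms by (intro Cauchy_inequality) (auto intro!: holomorphic_intros continuous_intros)
  ultimately show ?thesis
    by (simp add: norm_mult)
qed

text \<open>
  Each of the \<open>m + 1\<close> monomials has a coefficient of modulus at most \<open>B\<close> and Lipschitz constant at most \<open>m\<close>.
  Bernstein's inequality would give the better constant \<open>m B\<close>; any power of \<open>m\<close> serves the purpose here.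
\<close>

lemma poly_lipschitz_on_circle:
  fixes p :: "complex poly"
  assumes deg: "Polynomial.degree p \<le> m" and B: "\<And>z. cmod z = 1 \<Longrightarrow> cmod (poly p z) \<le> B"
    and zw: "cmod z = 1" "cmod w = 1"
  shows "cmod (poly p z - poly p w) \<le> B * real (m + 1) ^ 2 * cmod (z - w)"
proof -
  have B0: "0 \<le> B"
    using order_trans[OF norm_ge_zero B[of 1]] by simp
  have eq: "poly p x = (\<Sum>k\<le>m. Polynomial.coeff p k * x ^ k)" for x
    by (rule poly_eq_sum_le[OF deg])
  have "poly p z - poly p w = (\<Sum>k\<le>m. Polynomial.coeff p k * (z ^ k - w ^ k))"
    by (simp add: eq sum_subtractf algebra_simps)
  also have "cmod \<dots> \<le> (\<Sum>k\<le>m. B * (real (m + 1) * cmod (z - w)))"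
  proof (rule sum_norm_le)
    fix k assume k: "k \<in> {..m}"
    have "cmod (z ^ k - w ^ k) \<le> real k * cmod (z - w)"
      using zw by (intro norm_power_diff) auto
    also have "\<dots> \<le> real (m + 1) * cmod (z - w)"
      using k by (intro mult_right_mono) auto
    finally show "cmod (Polynomial.coeff p k * (z ^ k - w ^ k)) \<le> B * (real (m + 1) * cmod (z - w))"
      unfolding norm_mult using B0 by (intro mult_mono coeff_le_if_bounded_on_circle B) auto
  qed
  also have "\<dots> = B * real (m + 1) ^ 2 * cmod (z - w)"
    by (simp add: power2_eq_square algebra_simps)
  finally show ?thesis .
qed

text \<open>
  On the unit circle \<open>Re z = (z + 1/z) / 2\<close>, so \<open>z\<^sup>n p(Re z)\<close> is a polynomial in \<open>z\<close> of degree at most \<open>2 n\<close> with the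
  same modulus as \<open>p(Re z)\<close>. The Lipschitz estimate on the circle thereby applies to \<open>|p(Re z)|\<close>.
\<close>

lemma poly_Re_on_circle:
  fixes p :: "complex poly"
  assumes deg: "Polynomial.degree p \<le> n"
    and B: "\<And>x. x \<in> {-1..1} \<Longrightarrow> cmod (poly p (of_real x)) \<le> B"
    and zw: "cmod z = 1" "cmod w = 1"
  shows "cmod (poly p (of_real (Re w))) \<le>
         cmod (poly p (of_real (Re z))) + B * real (2 * n + 1) ^ 2 * cmod (z - w)"
proof -
  define g where "g = (\<Sum>k\<le>n. Polynomial.smult (Polynomial.coeff p k / 2 ^ k)
      (Polynomial.monom 1 (n - k) * [:1, 0, 1:] ^ k))"
  have g: "poly g u = u ^ n * poly p (of_real (Re u))" if "cmod u = 1" for u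
  proof -
    have "u * cnj u = 1"
      using that by (simp add: complex_norm_square[symmetric])
    hence u2: "1 + u * u = 2 * u * of_real (Re u)"
    proof -
      have "2 * u * of_real (Re u) = u * (u + cnj u)"
        by (simp only: complex_add_cnj) simp
      thus ?thesis
        using \<open>u * cnj u = 1\<close> by (simp only: distrib_left) simp
    qed
    have "poly g u = (\<Sum>k\<le>n. Polynomial.coeff p k / 2 ^ k * (u ^ (n - k) * (2 * u * of_real (Re u)) ^ k))"
      by (simp add: g_def poly_sum poly_monom u2)
    also have "\<dots> = (\<Sum>k\<le>n. u ^ n * (Polynomial.coeff p k * of_real (Re u) ^ k))"
    proof (rule sum.cong[OF refl])
      fix k assume "k \<in> {..n}"
      hence "u ^ n = u ^ (n - k) * u ^ k"
        by (simp flip: power_add)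
      thus "Polynomial.coeff p k / 2 ^ k * (u ^ (n - k) * (2 * u * of_real (Re u)) ^ k) =
            u ^ n * (Polynomial.coeff p k * of_real (Re u) ^ k)"
        by (simp add: power_mult_distrib)
    qed
    also have "\<dots> = u ^ n * poly p (of_real (Re u))"
      using poly_eq_sum_le[OF deg, of "of_real (Re u)"] by (simp add: sum_distrib_left)
    finally show ?thesis .
  qed
  have g_norm: "cmod (poly g u) = cmod (poly p (of_real (Re u)))" if "cmod u = 1" for u
    using g[OF that] that by (simp add: norm_mult norm_power)
  have deg_g: "Polynomial.degree g \<le> 2 * n"
    unfolding g_def
  proof (intro degree_sum_le order_trans[OF degree_smult_le] order_trans[OF degree_mult_le])
    fix k assume "k \<in> {..n}"
    thus "Polynomial.degree (Polynomial.monom (1 :: complex) (n - k)) +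
        Polynomial.degree ([:1, 0, 1 :: complex:] ^ k) \<le> 2 * n"
      using degree_power_le[of "[:1, 0, 1 :: complex:]" k] by (simp add: degree_monom_eq)
  qed simp
  have "cmod (poly g u) \<le> B" if "cmod u = 1" for u
    using B[of "Re u"] abs_Re_le_cmod[of u] that by (simp add: g_norm abs_le_iff)
  hence "cmod (poly g z - poly g w) \<le> B * real (2 * n + 1) ^ 2 * cmod (z - w)"
    using poly_lipschitz_on_circle[OF deg_g _ zw] by blast
  thus ?thesis
    using norm_triangle_sub[of "poly g w" "poly g z"] zw by (simp add: g_norm norm_minus_commute)
qed

text \<open>
  The points \<open>0\<close> and \<open>s\<close> are the real parts of \<open>\<i>\<close> and \<open>s + \<i> \<surd>(1 - s\<^sup>2)\<close>, whose distance is at most \<open>2 |s|\<close>.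
\<close>

lemma poly_lower_bound_centre:
  fixes p :: "complex poly"
  assumes deg: "Polynomial.degree p \<le> n"
    and B: "\<And>x. x \<in> {-1..1} \<Longrightarrow> cmod (poly p (of_real x)) \<le> B" and s: "s \<in> {-1..1}"
  shows "cmod (poly p 0) \<le> cmod (poly p (of_real s)) + B * real (2 * n + 1) ^ 2 * (2 * \<bar>s\<bar>)"
proof -
  define z where "z = Complex s (sqrt (1 - s ^ 2))"
  have s2: "s ^ 2 \<le> 1" using s by (simp add: abs_square_le_1 abs_le_iff)
  have z: "cmod z = 1"
    using s2 by (simp add: z_def cmod_def)
  have "1 - sqrt (1 - s ^ 2) \<le> s ^ 2"
  proof -
    have "1 - s ^ 2 = sqrt (1 - s ^ 2) * sqrt (1 - s ^ 2)"
      using s2 by simp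
    also have "\<dots> \<le> sqrt (1 - s ^ 2) * 1"
      using s2 by (intro mult_left_mono) auto
    finally show ?thesis by simp
  qed
  moreover have "cmod (z - \<i>) ^ 2 = 2 * (1 - sqrt (1 - s ^ 2))"
    using s2 by (simp add: z_def cmod_power2 power2_diff)
  ultimately have A: "1 - sqrt (1 - s ^ 2) \<le> s ^ 2" "cmod (z - \<i>) ^ 2 = 2 * (1 - sqrt (1 - s ^ 2))"
    by blast+
  have "cmod (z - \<i>) ^ 2 \<le> (2 * \<bar>s\<bar>) ^ 2"
  proof -
    have "cmod (z - \<i>) ^ 2 \<le> 4 * s ^ 2"
      unfolding A(2) by (rule order_trans[OF mult_left_mono[OF A(1)]]) auto
    thus ?thesis by (simp add: power_mult_distrib)
  qed
  hence "cmod (z - \<i>) \<le> 2 * \<bar>s\<bar>"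
    by (rule power2_le_imp_le) simp
  moreover have "0 \<le> B"
    using order_trans[OF norm_ge_zero B[of 0]] by simp
  ultimately have "B * real (2 * n + 1) ^ 2 * cmod (z - \<i>) \<le> B * real (2 * n + 1) ^ 2 * (2 * \<bar>s\<bar>)"
    by (intro mult_left_mono) auto
  moreover have "Re z = s" by (simp add: z_def)
  ultimately show ?thesis
    using poly_Re_on_circle[OF deg B z, of \<i>] by simp
qed

text \<open>
  After the substitution \<open>t = (1 - x) / 2\<close> the points \<open>0\<close> and \<open>t\<close> correspond to \<open>x = 1\<close> and \<open>x = 1 - 2 t\<close>. The
  points above them on the circle have distance exactly \<open>2 \<surd>t\<close>; the square root reflects the faster variation
  of polynomials near an endpoint.
\<close>

lemma poly_lower_bound_endpoint:
  fixes p :: "complex poly"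
  assumes deg: "Polynomial.degree p \<le> n"
    and B: "\<And>t. t \<in> {0..1} \<Longrightarrow> cmod (poly p (of_real t)) \<le> B" and t: "t \<in> {0..1}"
  shows "cmod (poly p 0) \<le> cmod (poly p (of_real t)) + B * real (2 * n + 1) ^ 2 * (2 * sqrt t)"
proof -
  define r where "r = pcompose p [:1/2, -1/2:]"
  have r: "poly r x = poly p ((1 - x) / 2)" for x
    by (simp add: r_def poly_pcompose field_simps)
  have r_of_real: "poly r (of_real x) = poly p (of_real ((1 - x) / 2))" for x :: real
    by (simp add: r)
  define z where "z = Complex (1 - 2 * t) (2 * sqrt (t * (1 - t)))"
  have tt: "0 \<le> t * (1 - t)" using t by simp
  have "cmod z ^ 2 = (1 - 2 * t) ^ 2 + 4 * (t * (1 - t))"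
    using tt by (simp add: z_def cmod_power2 power_mult_distrib)
  hence "cmod z ^ 2 = 1" by (simp add: power2_eq_square algebra_simps)
  hence z: "cmod z = 1"
    using norm_ge_zero[of z] by (simp add: power2_eq_1_iff)
  have "cmod (z - 1) ^ 2 = (2 * t) ^ 2 + 4 * (t * (1 - t))"
    using tt by (simp add: z_def cmod_power2 power_mult_distrib)
  also have "\<dots> = (2 * sqrt t) ^ 2"
    using t by (simp add: power_mult_distrib power2_eq_square algebra_simps)
  finally have "cmod (z - 1) = 2 * sqrt t"
    by (rule power2_eq_imp_eq) (use t in auto)
  moreover have "Polynomial.degree r \<le> n"
    unfolding r_def using degree_pcompose_le[of p "[:1/2, -1/2:]"] deg by simp
  moreover have "cmod (poly r (of_real x)) \<le> B" if "x \<in> {-1..1}" for x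
    unfolding r_of_real by (rule B) (use that in auto)
  moreover have "(1 - Re z) / 2 = t" by (simp add: z_def)
  ultimately show ?thesis
    using poly_Re_on_circle[of r n B z 1] z unfolding r_of_real by simp
qed

section \<open>Supremum norms\<close>

context
  fixes K :: "(complex ^ 'n::finite) set"
  assumes K: "compact K" "K \<noteq> {}"
begin

lemma sup_norm_attained:
  obtains x where "x \<in> K" "sup_norm K P = cmod (eval_poly P x)"
    "\<And>y. y \<in> K \<Longrightarrow> cmod (eval_poly P y) \<le> cmod (eval_poly P x)"
proof -
  obtain x where x: "x \<in> K" "\<And>y. y \<in> K \<Longrightarrow> cmod (eval_poly P y) \<le> cmod (eval_poly P x)"
    using continuous_attains_sup[OF K continuous_on_norm[OF continuous_on_eval_poly]] by blast
  moreover have "sup_norm K P = cmod (eval_poly P x)"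
    unfolding sup_norm_def using x by (intro cSup_eq_maximum) auto
  ultimately show thesis using that by blast
qed

lemma eval_le_sup_norm: "y \<in> K \<Longrightarrow> cmod (eval_poly P y) \<le> sup_norm K P"
  using sup_norm_attained[of P] by metis

lemma sup_norm_eqI:
  "x \<in> K \<Longrightarrow> (\<And>y. y \<in> K \<Longrightarrow> cmod (eval_poly P y) \<le> cmod (eval_poly P x)) \<Longrightarrow>
     sup_norm K P = cmod (eval_poly P x)"
  using sup_norm_attained[of P] by (metis order_antisym)

lemma spectral_norm_sup_norm:
  assumes unisolvent: "\<And>P. (\<And>x. x \<in> K \<Longrightarrow> eval_poly P x = 0) \<Longrightarrow> P = 0"
  shows "spectral_norm (sup_norm K)"
  unfolding spectral_norm_def poly_norm_def
proof (intro conjI allI impI)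
  fix P Q :: "'n cpoly" and c :: complex and n :: nat
  obtain x where x: "x \<in> K" "sup_norm K P = cmod (eval_poly P x)"
    "\<And>y. y \<in> K \<Longrightarrow> cmod (eval_poly P y) \<le> cmod (eval_poly P x)"
    by (rule sup_norm_attained[of P]) blast
  show "0 \<le> sup_norm K P"
    using x(2) by simp
  show "sup_norm K P = 0 \<longleftrightarrow> P = 0"
  proof
    assume "sup_norm K P = 0"
    hence "eval_poly P y = 0" if "y \<in> K" for y
      using eval_le_sup_norm[OF that, of P] by simp
    thus "P = 0" by (rule unisolvent)
  qed (use x(2) in simp)
  show "sup_norm K (scale_poly c P) = cmod c * sup_norm K P"
    unfolding x(2) using sup_norm_eqI[OF x(1), of "scale_poly c P"] x(3)
    by (simp add: eval_poly_scale norm_mult mult_left_mono)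
  show "sup_norm K (P ^ n) = sup_norm K P ^ n"
    unfolding x(2) using sup_norm_eqI[OF x(1), of "P ^ n"] x(3)
    by (simp add: eval_poly_power norm_power power_mono)
  obtain z where z: "z \<in> K" "sup_norm K (P + Q) = cmod (eval_poly (P + Q) z)"
    using sup_norm_attained[of "P + Q"] by metis
  show "sup_norm K (P + Q) \<le> sup_norm K P + sup_norm K Q"
    unfolding z(2) eval_poly_add
    by (intro norm_triangle_le add_mono eval_le_sup_norm z(1))
qed

end

section \<open>Minkowski's inequality\<close>

text \<open>
  Convexity extended from the positive reals to the boundary, where it amounts to \<open>u\<^sup>p \<le> u\<close> for \<open>0 \<le> u \<le> 1\<close>.
\<close>

lemma powr_convex_combination:
  fixes x y p u v :: real
  assumes "1 \<le> p" "0 \<le> x" "0 \<le> y" "0 \<le> u" "0 \<le> v" "u + v = 1"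
  shows "(u * x + v * y) powr p \<le> u * x powr p + v * y powr p"
proof -
  have boundary: "(a * b) powr p \<le> a * b powr p" if "0 \<le> a" "a \<le> 1" "0 \<le> b" for a b
    using powr_mono'[of 1 p a] that \<open>1 \<le> p\<close> by (simp add: powr_mult mult_right_mono)
  show ?thesis
  proof (cases "x = 0 \<or> y = 0")
    case True
    thus ?thesis using boundary[of u x] boundary[of v y] assms by auto
  next
    case False
    hence "(u *\<^sub>R x + v *\<^sub>R y) powr p \<le> u * x powr p + v * y powr p"
      using assms powr_convex[OF \<open>1 \<le> p\<close>] unfolding convex_on_def by (auto simp: less_le)
    thus ?thesis by simp
  qed
qed

text \<open>
  For any \<open>a\<close> and \<open>b\<close> exceeding the two norms, \<open>(f + g) / (a + b)\<close> is the convex combination of \<open>f / a\<close> and \<open>g / b\<close>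
  with weights \<open>a / (a + b)\<close> and \<open>b / (a + b)\<close>. Convexity of \<open>t\<^sup>p\<close> bounds the integral of its \<open>p\<close>-th power by \<open>1\<close>. Adding
  \<open>e / 2\<close> to each norm keeps \<open>a\<close> and \<open>b\<close> positive.
\<close>

lemma minkowski_inequality:
  fixes f g :: "'a \<Rightarrow> real"
  assumes p: "1 \<le> p" and nonneg: "\<And>x. 0 \<le> f x" "\<And>x. 0 \<le> g x"
    and int: "integrable M (\<lambda>x. f x powr p)" "integrable M (\<lambda>x. g x powr p)"
      "integrable M (\<lambda>x. (f x + g x) powr p)"
  shows "(LINT x|M. (f x + g x) powr p) powr (1 / p) \<le>
         (LINT x|M. f x powr p) powr (1 / p) + (LINT x|M. g x powr p) powr (1 / p)"
proof (rule field_le_epsilon)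
  fix e :: real assume e: "0 < e"
  let ?I = "\<lambda>f. LINT x|M. f x powr p"
  define a where "a = ?I f powr (1 / p) + e / 2"
  define b where "b = ?I g powr (1 / p) + e / 2"
  have pos: "0 < a" "0 < b"
    using e by (simp_all add: a_def b_def add_nonneg_pos)
  have I: "?I f \<le> a powr p" "?I g \<le> b powr p"
  proof -
    have "(?I f powr (1 / p)) powr p \<le> a powr p" "(?I g powr (1 / p)) powr p \<le> b powr p"
      using e p by (auto simp: a_def b_def intro!: powr_mono2)
    thus "?I f \<le> a powr p" "?I g \<le> b powr p"
      using p by (simp_all add: powr_powr)
  qed
  define u where "u = a / (a + b)"
  define v where "v = b / (a + b)"
  have uv: "0 \<le> u" "0 \<le> v" "u + v = 1" "u / a = 1 / (a + b)" "v / b = 1 / (a + b)"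
    using pos by (simp_all add: u_def v_def flip: add_divide_distrib)
  have pointwise: "((f x + g x) / (a + b)) powr p \<le>
      u / a powr p * f x powr p + v / b powr p * g x powr p" for x
  proof -
    have "(f x + g x) / (a + b) = u * (f x / a) + v * (g x / b)"
      using uv(4,5) by (metis (no_types, opaque_lifting) add_divide_distrib mult.commute mult.left_neutral times_divide_eq_left times_divide_eq_right)
    moreover have "(u * (f x / a) + v * (g x / b)) powr p \<le> u * (f x / a) powr p + v * (g x / b) powr p"
      using p nonneg pos uv by (intro powr_convex_combination) auto
    ultimately show ?thesis
      using pos nonneg by (simp add: powr_divide)
  qed
  have "(LINT x|M. ((f x + g x) / (a + b)) powr p) \<le>
      (LINT x|M. u / a powr p * f x powr p + v / b powr p * g x powr p)"
    using pointwise int pos nonneg by (intro integral_mono) (auto simp: powr_divide)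
  also have "\<dots> = u / a powr p * ?I f + v / b powr p * ?I g"
    using int by simp
  also have "\<dots> \<le> u / a powr p * a powr p + v / b powr p * b powr p"
    using I uv by (intro add_mono mult_left_mono) auto
  also have "\<dots> = 1"
    using pos uv by simp
  also have "(LINT x|M. ((f x + g x) / (a + b)) powr p) = ?I (\<lambda>x. f x + g x) / (a + b) powr p"
    using pos nonneg by (simp add: powr_divide)
  finally have "?I (\<lambda>x. f x + g x) \<le> (a + b) powr p"
    using pos by (simp add: divide_le_eq)
  hence "?I (\<lambda>x. f x + g x) powr (1 / p) \<le> ((a + b) powr p) powr (1 / p)"
    using p by (intro powr_mono2) auto
  also have "\<dots> = a + b"
    using p pos by (simp add: powr_powr)
  finally show "?I (\<lambda>x. f x + g x) powr (1 / p) \<le> ?I f powr (1 / p) + ?I g powr (1 / p) + e"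
    by (simp add: a_def b_def)
qed

section \<open>Polynomials on cuspidal sets\<close>

lemma ball_subset_if_le_set_dist:
  assumes "ereal r \<le> set_dist x (- E)"
  shows "ball x r \<subseteq> E"
proof
  fix y assume y: "y \<in> ball x r"
  show "y \<in> E"
  proof (rule ccontr)
    assume "y \<notin> E"
    hence "set_dist x (- E) \<le> ereal (dist x y)"
      unfolding set_dist_def by (intro INF_lower) auto
    with assms y show False
      by (metis ereal_less_eq(3) mem_ball not_le order_trans)
  qed
qed

text \<open>
  The point \<open>x\<close> is reached from \<open>y\<close> at a small parameter \<open>s\<close> on a segment \<open>y + t u\<close>, \<open>|t| \<le> 1\<close>, that stays in the ball
  of radius \<open>\<rho>\<close>, so that the univariate estimate at the centre of an interval applies. With \<open>2 n + 1 \<le> 3 n\<close>, the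
  constant \<open>144 = 2 * 9 * 8\<close> makes the loss \<open>S / 8\<close>.
\<close>

lemma eval_poly_lower_bound_on_ball:
  fixes P :: "'n::finite cpoly"
  assumes "total_degree P \<le> n" "1 \<le> n" and "0 < \<rho>"
    and S: "\<And>x. x \<in> ball y \<rho> \<Longrightarrow> cmod (eval_poly P (of_real_vec x)) \<le> S"
    and x: "x \<in> ball y (\<rho> / (144 * real n ^ 2))"
  shows "cmod (eval_poly P (of_real_vec y)) \<le> cmod (eval_poly P (of_real_vec x)) + S / 4"
proof -
  define s where "s = 1 / (144 * real n ^ 2)"
  have n: "1 \<le> real n" using \<open>1 \<le> n\<close> by simp
  have s: "0 < s" "s \<le> 1"
  proof -
    have "1 \<le> 144 * real n ^ 2"
      using one_le_power[OF n, of 2] by linarith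
    thus "0 < s" "s \<le> 1" using n by (simp_all add: s_def)
  qed
  define u where "u = (1 / s) *\<^sub>R (x - y)"
  have u: "norm u < \<rho>"
  proof -
    have "norm (x - y) < \<rho> * s"
      using x by (simp add: s_def dist_norm norm_minus_commute)
    thus ?thesis
      using s by (simp add: u_def divide_less_eq)
  qed
  have x_eq: "y + s *\<^sub>R u = x"
    using s by (simp add: u_def)
  obtain p where p: "Polynomial.degree p \<le> n * 1"
      "\<And>t. poly p (of_real t) = eval_poly P (of_real_vec (y + t *\<^sub>R u))"
    by (rule eval_poly_along_curve[of "\<lambda>t. y + t *\<^sub>R u" "\<lambda>i. [:y $ i, u $ i:]" 1 P n])
       (use assms in auto)
  have "cmod (poly p (of_real t)) \<le> S" if "t \<in> {-1..1}" for t
  proof -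
    have "\<bar>t\<bar> * norm u \<le> 1 * norm u"
      using that by (intro mult_right_mono) auto
    hence "y + t *\<^sub>R u \<in> ball y \<rho>"
      using u by (simp add: dist_norm)
    thus ?thesis unfolding p(2) by (rule S)
  qed
  hence "cmod (poly p 0) \<le> cmod (poly p (of_real s)) + S * real (2 * n + 1) ^ 2 * (2 * \<bar>s\<bar>)"
    using p(1) s by (intro poly_lower_bound_centre) auto
  also have "S * real (2 * n + 1) ^ 2 * (2 * \<bar>s\<bar>) \<le> S * (3 * real n) ^ 2 * (2 * \<bar>s\<bar>)"
  proof (intro mult_right_mono mult_left_mono power_mono)
    show "0 \<le> S"
      using order_trans[OF norm_ge_zero S[of y]] \<open>0 < \<rho>\<close> by simp
  qed (use n in auto)
  also have "\<dots> \<le> S / 4"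
    using n order_trans[OF norm_ge_zero S[of y]] \<open>0 < \<rho>\<close> by (simp add: s_def power_mult_distrib)
  finally show ?thesis
    using p(2)[of 0] p(2)[of s] x_eq by simp
qed

text \<open>
  Let \<open>|P|\<close> attain its maximum \<open>S\<close> over \<open>E\<close> at \<open>x\<close>. Along the curve \<open>h\<close> the polynomial has degree at most \<open>n d\<close>, so at a
  parameter \<open>t\<close> of order \<open>(n d)\<^sup>-\<^sup>4\<close> its modulus is still at least \<open>S / 2\<close>. There the ball of radius \<open>M t\<^sup>m\<close> lies in
  \<open>E\<close>, and in a concentric ball smaller by a factor of order \<open>n\<^sup>2\<close> the modulus drops by at most \<open>S / 4\<close> further. The
  final radius is a constant times \<open>n powr (- (4 m + 2))\<close>.
\<close>

lemma UPC_large_value_ball: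
  fixes E :: "(real ^ 'n::finite) set"
  assumes "compact E" "UPC E"
  obtains r0 \<kappa> where "0 < r0" "0 \<le> \<kappa>"
    "\<And>P n. total_degree P \<le> n \<Longrightarrow> 1 \<le> n \<Longrightarrow>
       \<exists>y. ball y (r0 * real n powr (- \<kappa>)) \<subseteq> E \<and>
           (\<forall>x\<in>ball y (r0 * real n powr (- \<kappa>)).
              sup_norm (of_real_vec ` E) P / 4 \<le> cmod (eval_poly P (of_real_vec x)))"
proof -
  have closed: "closure E = E"
    by (intro closure_closed compact_imp_closed assms)
  obtain M m d where "M > 0" "m > 0" "d \<ge> 1" and E: "E \<noteq> {}"
    and curve: "\<And>x. x \<in> E \<Longrightarrow> \<exists>h. polynomial_map d h \<and> h 0 = x \<and> h ` {0..1} \<subseteq> E \<and>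
        (\<forall>t\<in>{0..1}. ereal (M * t powr m) \<le> set_dist (h t) (- E))"
    using \<open>UPC E\<close> unfolding UPC_def closed by blast
  have K: "compact (of_real_vec ` E)" "of_real_vec ` E \<noteq> {}"
    using E \<open>compact E\<close> compact_continuous_image[OF continuous_on_of_real_vec] by auto
  define r0 where "r0 = M * (1 / (2 * (3 * real d)) ^ 4) powr m / 144"
  define \<kappa> where "\<kappa> = 4 * m + 2"
  show thesis
  proof
    show "0 < r0" "0 \<le> \<kappa>"
      using \<open>M > 0\<close> \<open>m > 0\<close> \<open>d \<ge> 1\<close> by (simp_all add: r0_def \<kappa>_def)
  next
    fix P :: "'n cpoly" and n :: nat
    assume deg: "total_degree P \<le> n" and n: "1 \<le> n"
    define S where "S = sup_norm (of_real_vec ` E) P"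
    have S_le: "cmod (eval_poly P (of_real_vec x)) \<le> S" if "x \<in> E" for x
      unfolding S_def using eval_le_sup_norm[OF K] that by blast
    obtain x where x: "x \<in> E" "cmod (eval_poly P (of_real_vec x)) = S"
      unfolding S_def using sup_norm_attained[OF K, of P] by (metis imageE)
    have S0: "0 \<le> S" using x(2) by (metis norm_ge_zero)
    obtain h where h: "polynomial_map d h" "h 0 = x" "h ` {0..1} \<subseteq> E"
        "\<And>t. t \<in> {0..1} \<Longrightarrow> ereal (M * t powr m) \<le> set_dist (h t) (- E)"
      using curve[OF x(1)] by blast
    obtain c where c: "\<And>i. Polynomial.degree (c i) \<le> d" "\<And>i t. h t $ i = poly (c i) t"
      using h(1) unfolding polynomial_map_def by blast
    obtain p where p: "Polynomial.degree p \<le> n * d"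
        "\<And>t. poly p (of_real t) = eval_poly P (of_real_vec (h t))"
      by (rule eval_poly_along_curve[of h c d P n, OF c(2,1) deg]) blast
    \<comment> \<open>an upper bound for \<open>2 n d + 1\<close> proportional to \<open>n\<close>, so that the final radius is exactly a power of \<open>n\<close> times a constant\<close>
    define w where "w = 3 * real d * real n"
    have nd: "1 \<le> real n * real d"
      using n \<open>d \<ge> 1\<close> mult_mono[of 1 "real n" 1 "real d"] by simp
    have w: "1 \<le> w" "real (2 * (n * d) + 1) \<le> w"
    proof -
      have "w = 3 * (real n * real d)" by (simp add: w_def)
      moreover have "real (2 * (n * d) + 1) = 2 * (real n * real d) + 1" by simp
      ultimately show "1 \<le> w" "real (2 * (n * d) + 1) \<le> w" using nd by linarith+
    qed
    \<comment> \<open>chosen so that the endpoint estimate loses \<open>S w\<^sup>2 * 2 \<surd>t = S / 2\<close>\<close>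
    define t where "t = 1 / (2 * w) ^ 4"
    have sqrt_t: "sqrt t = 1 / (2 * w) ^ 2"
      using w by (simp add: t_def real_sqrt_divide real_sqrt_unique[of "(2 * w) ^ 2"] flip: power_mult)
    have t: "0 < t" "t \<in> {0..1}"
    proof -
      have "1 \<le> (2 * w) ^ 4"
        using w(1) by (intro one_le_power) linarith
      moreover have "0 < (2 * w) ^ 4"
        using w(1) by (intro zero_less_power) linarith
      ultimately show "0 < t" "t \<in> {0..1}"
        unfolding t_def by (auto intro: divide_le_eq_1_pos[THEN iffD2])
    qed
    have "cmod (poly p 0) \<le> cmod (poly p (of_real t)) + S * real (2 * (n * d) + 1) ^ 2 * (2 * sqrt t)"
      using p h(3) t by (intro poly_lower_bound_endpoint) (auto intro!: S_le)
    also have "S * real (2 * (n * d) + 1) ^ 2 * (2 * sqrt t) \<le> S * w ^ 2 * (2 * sqrt t)"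
      using w S0 t by (intro mult_right_mono mult_left_mono power_mono) auto
    also have "\<dots> = S / 2"
      using w(1) by (simp add: sqrt_t power_mult_distrib)
    finally have half: "S / 2 \<le> cmod (eval_poly P (of_real_vec (h t)))"
      using p(2)[of 0] h(2) x(2) by (simp add: p(2))
    define \<rho> where "\<rho> = M * t powr m"
    have \<rho>: "0 < \<rho>" "ball (h t) \<rho> \<subseteq> E"
      using \<open>M > 0\<close> t ball_subset_if_le_set_dist[OF h(4)] by (simp_all add: \<rho>_def)
    have "t = 1 / (2 * (3 * real d)) ^ 4 * real n powr (- 4)"
      using n by (simp add: t_def w_def power_mult_distrib powr_minus_divide)
    hence "t powr m = (1 / (2 * (3 * real d)) ^ 4 * real n powr (- 4)) powr m"
      by simp
    also have "\<dots> = (1 / (2 * (3 * real d)) ^ 4) powr m * (real n powr (- 4)) powr m"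
      by (rule powr_mult)
    also have "(real n powr (- 4)) powr m = real n powr (- (4 * m))"
      by (simp add: powr_powr)
    finally have "t powr m = (1 / (2 * (3 * real d)) ^ 4) powr m * real n powr (- (4 * m))" .
    moreover have "real n powr (- \<kappa>) = real n powr (- (4 * m)) / real n ^ 2"
      using n by (simp add: \<kappa>_def powr_diff powr_minus_divide powr_add)
    ultimately have r_eq: "r0 * real n powr (- \<kappa>) = \<rho> / (144 * real n ^ 2)"
      by (simp add: r0_def \<rho>_def)
    have "1 \<le> real n ^ 2"
      using n by (intro one_le_power) simp
    hence "1 \<le> 144 * real n ^ 2" by linarith
    hence "\<rho> / (144 * real n ^ 2) \<le> \<rho> / 1"
      using \<rho>(1) by (intro divide_left_mono) linarith+
    hence "ball (h t) (r0 * real n powr (- \<kappa>)) \<subseteq> E"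
      unfolding r_eq by (intro order_trans[OF subset_ball \<rho>(2)]) simp
    moreover have "S / 4 \<le> cmod (eval_poly P (of_real_vec z))"
      if z: "z \<in> ball (h t) (r0 * real n powr (- \<kappa>))" for z
    proof -
      have "cmod (eval_poly P (of_real_vec (h t))) \<le> cmod (eval_poly P (of_real_vec z)) + S / 4"
        using \<rho> z S_le unfolding r_eq by (intro eval_poly_lower_bound_on_ball[OF deg n]) auto
      thus ?thesis using half by simp
    qed
    ultimately show "\<exists>y. ball y (r0 * real n powr (- \<kappa>)) \<subseteq> E \<and>
           (\<forall>x\<in>ball y (r0 * real n powr (- \<kappa>)).
              sup_norm (of_real_vec ` E) P / 4 \<le> cmod (eval_poly P (of_real_vec x)))"
      unfolding S_def by blast
  qed
qed

section \<open>\<open>L\<^sup>p\<close> norms on compact sets of positive measure\<close>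

context
  fixes E :: "(real ^ 'n::finite) set" and p :: real and \<mu>
  defines "\<mu> \<equiv> uniform_measure lborel E"
  assumes E: "compact E" "0 < measure lborel E" and p: "1 \<le> p"
begin

lemma emeasure_lborel_E: "emeasure lborel E \<noteq> 0" "emeasure lborel E \<noteq> \<infinity>"
  using E emeasure_compact_finite[OF E(1)] by (auto simp: measure_def)

lemma prob_space_\<mu>: "prob_space \<mu>"
  unfolding \<mu>_def by (rule prob_space_uniform_measure) (use emeasure_lborel_E in auto)

lemma sets_\<mu> [measurable_cong]: "sets \<mu> = sets borel"
  by (simp add: \<mu>_def)

lemma E_sets: "E \<in> sets borel"
  using E(1) compact_imp_closed borel_closed by blast

lemma AE_\<mu>: "AE x in \<mu>. x \<in> E"
  unfolding \<mu>_def by (rule AE_uniform_measureI) (use E_sets in auto)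

lemma of_real_vec_E: "compact (of_real_vec ` E)" "of_real_vec ` E \<noteq> {}"
  using E compact_continuous_image[OF continuous_on_of_real_vec] by auto

lemma integrable_continuous_\<mu>:
  fixes f :: "real ^ 'n \<Rightarrow> real"
  assumes f: "continuous_on UNIV f"
  shows "integrable \<mu> f"
proof -
  interpret prob_space \<mu> by (rule prob_space_\<mu>)
  have "bounded (f ` E)"
    using E(1) f by (intro compact_imp_bounded compact_continuous_image) (auto intro: continuous_on_subset)
  then obtain B where B: "\<And>x. x \<in> E \<Longrightarrow> norm (f x) \<le> B"
    by (auto simp: bounded_iff)
  have [measurable]: "f \<in> borel_measurable \<mu>"
    using borel_measurable_continuous_onI[OF f] by measurable
  show ?thesis
    by (rule integrable_const_bound[where B = B]) (use AE_\<mu> B in auto)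
qed

lemma integrable_powr_eval_poly:
  "integrable \<mu> (\<lambda>x. cmod (eval_poly P (of_real_vec x)) powr p)"
  using p by (intro integrable_continuous_\<mu> continuous_on_powr' continuous_intros
      continuous_on_eval_poly_of_real_vec) auto

lemma Lp_norm_eq: "Lp_norm p E P = (LINT x|\<mu>. cmod (eval_poly P (of_real_vec x)) powr p) powr (1 / p)"
  by (simp add: Lp_norm_def \<mu>_def)

lemma Lp_norm_scale: "Lp_norm p E (scale_poly c P) = cmod c * Lp_norm p E P"
  using p by (simp add: Lp_norm_eq eval_poly_scale norm_mult powr_mult powr_powr integral_nonneg_AE)

lemma Lp_norm_triangle: "Lp_norm p E (P + Q) \<le> Lp_norm p E P + Lp_norm p E Q"
proof -
  let ?f = "\<lambda>P x. cmod (eval_poly P (of_real_vec x))"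
  have int: "integrable \<mu> (\<lambda>x. (?f P x + ?f Q x) powr p)"
    using p by (intro integrable_continuous_\<mu> continuous_on_powr' continuous_intros
        continuous_on_eval_poly_of_real_vec) auto
  have "Lp_norm p E (P + Q) \<le> (LINT x|\<mu>. (?f P x + ?f Q x) powr p) powr (1 / p)"
    unfolding Lp_norm_eq eval_poly_add using p int integrable_powr_eval_poly[of "P + Q"]
    by (intro powr_mono2 integral_mono integral_nonneg_AE)
       (auto simp: eval_poly_add intro!: powr_mono2 norm_triangle_ineq)
  also have "\<dots> \<le> Lp_norm p E P + Lp_norm p E Q"
    unfolding Lp_norm_eq using p int by (intro minkowski_inequality integrable_powr_eval_poly) auto
  finally show ?thesis .
qed

lemma Lp_norm_le_sup_norm: "Lp_norm p E P \<le> sup_norm (of_real_vec ` E) P"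
proof -
  interpret prob_space \<mu> by (rule prob_space_\<mu>)
  let ?S = "sup_norm (of_real_vec ` E) P"
  have le: "cmod (eval_poly P (of_real_vec x)) \<le> ?S" if "x \<in> E" for x
    using eval_le_sup_norm[OF of_real_vec_E] that by blast
  obtain x where "x \<in> E" using of_real_vec_E(2) by blast
  hence S: "0 \<le> ?S" using order_trans[OF norm_ge_zero le] by blast
  have "(LINT x|\<mu>. cmod (eval_poly P (of_real_vec x)) powr p) \<le> (LINT x|\<mu>. ?S powr p)"
  proof (rule integral_mono_AE[OF integrable_powr_eval_poly])
    show "AE x in \<mu>. cmod (eval_poly P (of_real_vec x)) powr p \<le> ?S powr p"
      using AE_\<mu> by eventually_elim (use le p in \<open>auto intro: powr_mono2\<close>)
  qed simp
  also have "\<dots> = ?S powr p"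
    by (simp add: prob_space)
  finally have "Lp_norm p E P \<le> (?S powr p) powr (1 / p)"
    unfolding Lp_norm_eq using p by (intro powr_mono2 integral_nonneg_AE) auto
  thus ?thesis using p S by (simp add: powr_powr)
qed

lemma Lp_norm_ge:
  assumes "0 \<le> s" "0 \<le> r" "ball y r \<subseteq> E"
    and lower: "\<And>x. x \<in> ball y r \<Longrightarrow> s \<le> cmod (eval_poly P (of_real_vec x))"
  shows "s * (measure lborel (ball y r) / measure lborel E) powr (1 / p) \<le> Lp_norm p E P"
proof -
  interpret prob_space \<mu> by (rule prob_space_\<mu>)
  have "s powr p * measure \<mu> (ball y r) = (LINT x|\<mu>. s powr p * indicator (ball y r) x)"
    using sets_eq_imp_space_eq[OF sets_\<mu>] by simp
  also have "\<dots> \<le> (LINT x|\<mu>. cmod (eval_poly P (of_real_vec x)) powr p)"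
    using assms(1) p
    by (intro integral_mono integrable_powr_eval_poly integrable_mult_right integrable_real_indicator)
       (auto simp: indicator_def less_top[symmetric] intro!: powr_mono2 lower split: if_splits)
  finally have "(s powr p * measure \<mu> (ball y r)) powr (1 / p) \<le> Lp_norm p E P"
    unfolding Lp_norm_eq using p by (intro powr_mono2) auto
  moreover have "measure \<mu> (ball y r) = measure lborel (ball y r) / measure lborel E"
    using emeasure_lborel_E assms(3) by (simp add: \<mu>_def Int_absorb1)
  moreover have "(s powr p * c) powr (1 / p) = s * c powr (1 / p)" for c
    using assms(1) p by (simp add: powr_mult powr_powr)
  ultimately show ?thesis by metis
qed

end

lemma UPC_contains_ball:
  assumes "UPC E" "compact E"
  obtains y r where "0 < r" "ball y r \<subseteq> E"
proof -
  have closed: "closure E = E"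
    by (intro closure_closed compact_imp_closed assms)
  obtain M m x h where "M > 0" "x \<in> E"
    and h: "\<forall>t\<in>{0..1}. ereal (M * t powr m) \<le> set_dist (h t) (- E)"
    using assms(1) unfolding UPC_def closed by (metis ex_in_conv)
  have "ball (h 1) M \<subseteq> E"
    using h[rule_format, of 1] by (intro ball_subset_if_le_set_dist) simp
  thus thesis using that \<open>M > 0\<close> by blast
qed

lemma measure_lborel_ball:
  fixes y :: "real ^ 'n::finite"
  assumes "0 \<le> r"
  shows "measure lborel (ball y r) = unit_ball_vol (real CARD('n)) * r ^ CARD('n)"
  using content_ball[OF assms, of y] by simp

text \<open>
  The ball on which \<open>|P|\<close> is at least a quarter of its maximum has measure a constant times \<open>n powr (- \<kappa> N)\<close>. Its
  contribution to the integral alone gives \<open>\<parallel>P\<parallel>\<^sub>E \<le> A n\<^sup>a \<parallel>P\<parallel>\<^sub>p\<close> with \<open>a = \<kappa> N / p\<close>, which also shows that the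
  \<open>L\<^sup>p\<close> norm vanishes only at \<open>0\<close>.
\<close>

theorem generalized_nikolskii_Lp_norm:
  fixes E :: "(real ^ 'n::finite) set"
  assumes E: "compact E" "UPC E" and p: "1 \<le> p"
  shows "generalized_nikolskii (Lp_norm p E) (sup_norm (of_real_vec ` E))"
proof -
  let ?S = "sup_norm (of_real_vec ` E)" and ?L = "Lp_norm p E" and ?N = "CARD('n)"
  obtain y0 r1 where ball: "0 < r1" "ball y0 r1 \<subseteq> E"
    by (rule UPC_contains_ball[OF E(2,1)])
  have "measure lborel (ball y0 r1) \<le> measure lborel E"
    using ball(2) E(1) by (intro measure_mono_fmeasurable fmeasurable_compact) auto
  moreover have "0 < measure lborel (ball y0 r1)"
    by (subst measure_lborel_ball) (use ball(1) in auto)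
  ultimately have mE: "0 < measure lborel E" by linarith
  note K = of_real_vec_E[OF E(1) mE p]
  have spectral: "spectral_norm ?S"
  proof (rule spectral_norm_sup_norm[OF K])
    fix P :: "'n cpoly" assume "\<And>x. x \<in> of_real_vec ` E \<Longrightarrow> eval_poly P x = 0"
    thus "P = 0"
      using ball by (intro cpoly_eq_0_if_vanishes_on_ball[of r1 y0]) auto
  qed
  note norm = spectral_norm_imp_poly_norm[OF spectral]
  obtain r0 \<kappa> where r0: "0 < r0" and \<kappa>: "0 \<le> \<kappa>"
    and large: "\<And>P n. total_degree P \<le> n \<Longrightarrow> 1 \<le> n \<Longrightarrow>
       \<exists>y. ball y (r0 * real n powr (- \<kappa>)) \<subseteq> E \<and>
           (\<forall>x\<in>ball y (r0 * real n powr (- \<kappa>)). ?S P / 4 \<le> cmod (eval_poly P (of_real_vec x)))"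
    by (rule UPC_large_value_ball[OF E]) blast
  define C where "C = (unit_ball_vol (real ?N) * r0 ^ ?N / measure lborel E) powr (1 / p)"
  have C: "0 < C"
    using r0 mE less_imp_neq[OF unit_ball_vol_pos[of "real ?N"]] by (simp add: C_def)
  define a where "a = \<kappa> * real ?N / p"
  have a: "0 \<le> a" using \<kappa> p by (simp add: a_def)
  have nikolskii: "?S P \<le> 4 / C * real n powr a * ?L P" if deg: "total_degree P \<le> n" and n: "1 \<le> n" for P n
  proof -
    define r where "r = r0 * real n powr (- \<kappa>)"
    have r: "0 < r" using r0 n by (simp add: r_def)
    obtain y where y: "ball y r \<subseteq> E" "\<And>x. x \<in> ball y r \<Longrightarrow> ?S P / 4 \<le> cmod (eval_poly P (of_real_vec x))"
      using large[OF deg n] unfolding r_def by blast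
    have "?S P / 4 * (measure lborel (ball y r) / measure lborel E) powr (1 / p) \<le> ?L P"
      using poly_norm_nonneg[OF norm] r y by (intro Lp_norm_ge[OF E(1) mE p]) auto
    also have "measure lborel (ball y r) / measure lborel E =
        unit_ball_vol (real ?N) * r0 ^ ?N / measure lborel E * real n powr (- \<kappa> * real ?N)"
      using r n by (simp add: measure_lborel_ball r_def power_mult_distrib powr_power mult.commute)
    also have "\<dots> powr (1 / p) = C * real n powr (- a)"
      unfolding powr_mult C_def[symmetric] a_def by (simp add: powr_powr)
    finally show ?thesis
      using C n by (simp add: powr_minus_divide field_simps)
  qed
  have "poly_norm ?L"
    unfolding poly_norm_def
  proof (intro conjI allI)
    fix P Q :: "'n cpoly" and c
    show "0 \<le> ?L P" by (simp add: Lp_norm_def)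
    show "?L P = 0 \<longleftrightarrow> P = 0"
    proof
      assume "?L P = 0"
      hence "?S P \<le> 0"
        using nikolskii[of P "max 1 (total_degree P)"] by simp
      hence "?S P = 0"
        using poly_norm_nonneg[OF norm, of P] by simp
      thus "P = 0"
        by (simp add: poly_norm_eq_0_iff[OF norm])
    next
      assume "P = 0"
      thus "?L P = 0"
        using Lp_norm_scale[OF E(1) mE p, of 0 P] by (simp add: scale_poly_conv_mult)
    qed
    show "?L (scale_poly c P) = cmod c * ?L P"
      by (rule Lp_norm_scale[OF E(1) mE p])
    show "?L (P + Q) \<le> ?L P + ?L Q"
      by (rule Lp_norm_triangle[OF E(1) mE p])
  qed
  moreover have "?L P \<le> 1 * real (total_degree P) powr 0 * ?S P" if "1 \<le> total_degree P" for P
    using Lp_norm_le_sup_norm[OF E(1) mE p, of P] that by simp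
  moreover have "0 < 4 / C" using C by simp
  ultimately show ?thesis
    unfolding generalized_nikolskii_def
    using spectral nikolskii[OF order_refl] a zero_less_one order_refl[of "0::real"] by blast
qed

section \<open>Comparison of the exponents\<close>

theorem corollary26:
  shows
    "(\<forall>(q :: 'n::finite cpoly \<Rightarrow> real) q\<^sub>\<sigma>. generalized_nikolskii q q\<^sub>\<sigma> \<longrightarrow>
        (asymptotic_exponent q = markov_exponent q \<longleftrightarrow> markov_exponent q = markov_exponent q\<^sub>\<sigma>)) \<and>
     (\<forall>(q :: 'n cpoly \<Rightarrow> real) q\<^sub>\<sigma> r M. generalized_nikolskii q q\<^sub>\<sigma> \<longrightarrow>
        markov_exponent q\<^sub>\<sigma> = ereal r \<longrightarrow> 0 < M \<longrightarrow> markov_inequality q M r \<longrightarrow>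
        (\<forall>s<r. \<not> (\<exists>M'>0. markov_inequality q M' s)) \<and>
        markov_exponent q = markov_exponent q\<^sub>\<sigma>) \<and>
     (\<forall>(E :: (real ^ 'n) set) p. compact E \<longrightarrow> UPC E \<longrightarrow> 1 \<le> p \<longrightarrow>
        set_markov_exponent (of_real_vec ` E) \<le> markov_exponent (Lp_norm p E))"
proof (intro conjI allI impI)
  fix q q\<^sub>\<sigma> :: "'n cpoly \<Rightarrow> real"
  assume "generalized_nikolskii q q\<^sub>\<sigma>"
  thus "asymptotic_exponent q = markov_exponent q \<longleftrightarrow> markov_exponent q = markov_exponent q\<^sub>\<sigma>"
    using asymptotic_exponent_eq_markov_exponent_spectral by metis
next
  fix q q\<^sub>\<sigma> :: "'n cpoly \<Rightarrow> real" and r M :: real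
  assume nik: "generalized_nikolskii q q\<^sub>\<sigma>" and r: "markov_exponent q\<^sub>\<sigma> = ereal r"
    and M: "0 < M" "markov_inequality q M r"
  have lower: "r \<le> s" if "0 < M'" "markov_inequality q M' s" for M' s
  proof -
    have "markov_exponent q \<le> ereal s"
      using markov_inequality_imp_markov_exponent_le[OF that markov_inequality_exponent_pos[OF nik that]] .
    with markov_exponent_spectral_le[OF nik] r show ?thesis
      by (metis ereal_less_eq(3) order_trans)
  qed
  show "\<not> (\<exists>M'>0. markov_inequality q M' s)" if "s < r" for s
    using lower that by fastforce
  show "markov_exponent q = markov_exponent q\<^sub>\<sigma>"
    using markov_inequality_imp_markov_exponent_le[OF M markov_inequality_exponent_pos[OF nik M]]
      markov_exponent_spectral_le[OF nik] r by simp
next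
  fix E :: "(real ^ 'n) set" and p :: real
  assume "compact E" "UPC E" "1 \<le> p"
  thus "set_markov_exponent (of_real_vec ` E) \<le> markov_exponent (Lp_norm p E)"
    unfolding set_markov_exponent_def
    by (intro markov_exponent_spectral_le generalized_nikolskii_Lp_norm)
qed

end
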